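(* Let $W=\{W(t):t\in[a,b]\}$ be a Brownian motion, and for $f,h\in W^{2,2}$ let $$\varepsilon(f,h)=-\frac12\int_a^b f'(t)h'(t)\,dt+\int_a^b\frac12\left[f''(t)h(t)+f'(t)h'(t)\right]W(t)\,dt.$$ Write $\varepsilon=\varepsilon_1+\varepsilon_2$ with $$\varepsilon_1(f,h):=-\int_a^b\frac{f'h'}{4}\,dt+\int_a^b\frac{f''hW}{4}\,dt+\int_a^b\frac{fh''W}{4}\,dt+\int_a^b\frac{f'h'W}{2}\,dt,$$ $$\varepsilon_2(f,h):=-\int_a^b\frac{f'h'}{4}\,dt+\frac14\int_a^b f''hW\,dt-\frac14\int_a^b fh''W\,dt.$$ Then there exist operators $L_1$ and $L_2$ on $W^{2,2}$ such that $\varepsilon_1(f,g)=\langle L_1f,g\rangle_2$ and $\varepsilon_2(f,g)=\langle L_2f,g\rangle_2$ for all $f,g\in W^{2,2}$; hence the bilinear form $\varepsilon$ is associated with the operator $L_1+L_2$, that is, $\varepsilon(f,g)=\langle(L_1+L_2)f,g\rangle_2$ for all $f,g\in W^{2,2}$.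
   Context: Fix real numbers $a<b$ and a Brownian motion $W=\{W(t):t\in[a,b]\}$ with continuous paths; the forms and operators are considered for each fixed (continuous) path of $W$. $W^{2,2}$ denotes the Sobolev space $\{h\in L_2[a,b]: h',h''\in L_2[a,b],\ h(a)=h(b)=0\}$ of real functions (derivatives in the Sobolev sense), a Hilbert space with inner product $\langle f,g\rangle_2=\int_a^b fg\,dx+\int_a^b f'g'\,dx+\int_a^b f''g''\,dx$. The form $\varepsilon$ is, by Itô's formula, the expression on $W^{2,2}$ of $-\int_a^b\frac{f'h'}{2}\,dt-\int_a^b\frac{f'h}{2}\,dW(t)$, the weak version of the formal operator $f\mapsto\frac{f''}{2}-\frac{W'f'}{2}$. *)

theory Defs
  imports "HOL-Probability.Probability"
begin

section \<open>Brownian motion on a compact interval\<close>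

text \<open>
  The initial value \<open>W a\<close> may be any random variable independent of the increments. This covers
  both the normalisation \<open>W a = 0\<close> and the restriction to \<open>{a..b}\<close> of a Brownian motion started
  at an earlier time. The process is indexed by all reals, but only times in \<open>{a..b}\<close> are
  constrained.
\<close>

definition brownian_motion_on ::
    "'w measure \<Rightarrow> real \<Rightarrow> real \<Rightarrow> (real \<Rightarrow> 'w \<Rightarrow> real) \<Rightarrow> bool" where
  "brownian_motion_on M a b W \<longleftrightarrow>
     prob_space M \<and>
     (\<forall>t\<in>{a..b}. W t \<in> borel_measurable M) \<and>
     (\<forall>s t. a \<le> s \<and> s < t \<and> t \<le> b \<longrightarrow>
        distributed M lborel (\<lambda>\<omega>. W t \<omega> - W s \<omega>) (normal_density 0 (sqrt (t - s)))) \<and>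
     (\<forall>(n::nat) \<tau>. \<tau> 0 = a \<and> (\<forall>i<n. \<tau> i < \<tau> (Suc i)) \<and> \<tau> n \<le> b \<longrightarrow>
        prob_space.indep_vars M (\<lambda>_. borel)
          (\<lambda>i \<omega>. if i = 0 then W a \<omega> else W (\<tau> i) \<omega> - W (\<tau> (i - 1)) \<omega>) {..n}) \<and>
     (\<forall>\<omega>\<in>space M. continuous_on {a..b} (\<lambda>t. W t \<omega>))"


section \<open>Sobolev derivatives and the space \<open>W\<^sup>2\<^sup>,\<^sup>2\<close>\<close>

definition L2_on :: "real \<Rightarrow> real \<Rightarrow> (real \<Rightarrow> real) set" where
  "L2_on a b = {f. f \<in> borel_measurable (lebesgue_on {a..b}) \<and>
                   integrable (lebesgue_on {a..b}) (\<lambda>x. (f x)\<^sup>2)}"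

definition integral_on :: "real \<Rightarrow> real \<Rightarrow> (real \<Rightarrow> real) \<Rightarrow> real" where
  "integral_on a b f = integral\<^sup>L (lebesgue_on {a..b}) f"

text \<open>The smooth functions with compact support in the open interval \<open>{a<..<b}\<close>.\<close>

definition test_functions :: "real \<Rightarrow> real \<Rightarrow> (real \<Rightarrow> real) set" where
  "test_functions a b =
     {\<phi>. (\<forall>n x. (deriv ^^ n) \<phi> differentiable (at x)) \<and>
         (\<exists>c d. a < c \<and> d < b \<and> (\<forall>x. x \<notin> {c..d} \<longrightarrow> \<phi> x = 0))}"

definition has_sobolev_deriv :: "real \<Rightarrow> real \<Rightarrow> (real \<Rightarrow> real) \<Rightarrow> (real \<Rightarrow> real) \<Rightarrow> bool" where
  "has_sobolev_deriv a b f g \<longleftrightarrow>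
     f \<in> L2_on a b \<and> g \<in> L2_on a b \<and>
     (\<forall>\<phi>\<in>test_functions a b.
        integral_on a b (\<lambda>x. f x * deriv \<phi> x) = - integral_on a b (\<lambda>x. g x * \<phi> x))"

text \<open>
  A chosen representative of the derivative; it is determined only up to a null set, so it is
  meant to be used under integrals only.
\<close>

definition sobolev_deriv :: "real \<Rightarrow> real \<Rightarrow> (real \<Rightarrow> real) \<Rightarrow> real \<Rightarrow> real" where
  "sobolev_deriv a b f = (SOME g. has_sobolev_deriv a b f g)"

abbreviation sobolev_deriv2 :: "real \<Rightarrow> real \<Rightarrow> (real \<Rightarrow> real) \<Rightarrow> real \<Rightarrow> real" where
  "sobolev_deriv2 a b f \<equiv> sobolev_deriv a b (sobolev_deriv a b f)"

text \<open>
  In one dimension every class in the Sobolev space has exactly one continuous representative on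
  \<open>{a..b}\<close>, and the boundary conditions refer to it. A class is encoded by this representative,
  extended by \<open>0\<close> outside \<open>{a..b}\<close>, so that equality of functions is equality of classes and the
  vector space operations are pointwise. The extension plays no role in the derivatives, which
  are taken on the open interval.
\<close>

definition W22 :: "real \<Rightarrow> real \<Rightarrow> (real \<Rightarrow> real) set" where
  "W22 a b =
     {h. continuous_on {a..b} h \<and> (\<forall>x. x \<notin> {a..b} \<longrightarrow> h x = 0) \<and>
         (\<exists>h' h''. has_sobolev_deriv a b h h' \<and> has_sobolev_deriv a b h' h'') \<and>
         h a = 0 \<and> h b = 0}"

definition inner22 :: "real \<Rightarrow> real \<Rightarrow> (real \<Rightarrow> real) \<Rightarrow> (real \<Rightarrow> real) \<Rightarrow> real" where
  "inner22 a b f g =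
     integral_on a b (\<lambda>x. f x * g x) +
     integral_on a b (\<lambda>x. sobolev_deriv a b f x * sobolev_deriv a b g x) +
     integral_on a b (\<lambda>x. sobolev_deriv2 a b f x * sobolev_deriv2 a b g x)"

definition norm22 :: "real \<Rightarrow> real \<Rightarrow> (real \<Rightarrow> real) \<Rightarrow> real" where
  "norm22 a b f = sqrt (inner22 a b f f)"

text \<open>Everywhere defined bounded linear operators; values off the space are irrelevant.\<close>

definition operator_on_W22 ::
    "real \<Rightarrow> real \<Rightarrow> ((real \<Rightarrow> real) \<Rightarrow> real \<Rightarrow> real) \<Rightarrow> bool" where
  "operator_on_W22 a b L \<longleftrightarrow>
     (\<forall>f\<in>W22 a b. L f \<in> W22 a b) \<and>
     (\<forall>f\<in>W22 a b. \<forall>g\<in>W22 a b. \<forall>c d.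
        L (\<lambda>x. c * f x + d * g x) = (\<lambda>x. c * L f x + d * L g x)) \<and>
     (\<exists>K. \<forall>f\<in>W22 a b. norm22 a b (L f) \<le> K * norm22 a b f)"


section \<open>The bilinear forms for a fixed path \<open>w\<close>\<close>

definition form_eps ::
    "real \<Rightarrow> real \<Rightarrow> (real \<Rightarrow> real) \<Rightarrow> (real \<Rightarrow> real) \<Rightarrow> (real \<Rightarrow> real) \<Rightarrow> real" where
  "form_eps a b w f h =
     - (1/2) * integral_on a b (\<lambda>t. sobolev_deriv a b f t * sobolev_deriv a b h t) +
     integral_on a b (\<lambda>t. 1/2 * (sobolev_deriv2 a b f t * h t +
                                 sobolev_deriv a b f t * sobolev_deriv a b h t) * w t)"

definition form_eps1 ::
    "real \<Rightarrow> real \<Rightarrow> (real \<Rightarrow> real) \<Rightarrow> (real \<Rightarrow> real) \<Rightarrow> (real \<Rightarrow> real) \<Rightarrow> real" where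
  "form_eps1 a b w f h =
     - integral_on a b (\<lambda>t. sobolev_deriv a b f t * sobolev_deriv a b h t / 4) +
     integral_on a b (\<lambda>t. sobolev_deriv2 a b f t * h t * w t / 4) +
     integral_on a b (\<lambda>t. f t * sobolev_deriv2 a b h t * w t / 4) +
     integral_on a b (\<lambda>t. sobolev_deriv a b f t * sobolev_deriv a b h t * w t / 2)"

definition form_eps2 ::
    "real \<Rightarrow> real \<Rightarrow> (real \<Rightarrow> real) \<Rightarrow> (real \<Rightarrow> real) \<Rightarrow> (real \<Rightarrow> real) \<Rightarrow> real" where
  "form_eps2 a b w f h =
     - integral_on a b (\<lambda>t. sobolev_deriv a b f t * sobolev_deriv a b h t / 4) +
     1/4 * integral_on a b (\<lambda>t. sobolev_deriv2 a b f t * h t * w t) -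
     1/4 * integral_on a b (\<lambda>t. f t * sobolev_deriv2 a b h t * w t)"

end

theory Submission
  imports Defs "HOL-Computational_Algebra.Polynomial"
begin

text \<open>
  Elements of \<open>W\<^sup>2\<^sup>,\<^sup>2\<close> and their first derivatives have absolutely continuous representatives
  (du Bois-Reymond). Since \<open>g\<close> vanishes at both ends, integration by parts rewrites each of
  \<open>\<epsilon>\<^sub>1(f, g)\<close> and \<open>\<epsilon>\<^sub>2(f, g)\<close> as \<open>\<integral> R g''\<close> with a continuous \<open>R\<close> depending on \<open>f\<close> and the path.
  Instead of using completeness of \<open>W\<^sup>2\<^sup>,\<^sup>2\<close>, the Riesz representer of \<open>g \<mapsto> \<integral> R g''\<close> is written down:
  it is \<open>h = z''\<close> where \<open>z'''' - z'' + z = R\<close> and \<open>z\<close>, \<open>z''\<close> vanish at \<open>a\<close> and \<open>b\<close>. Linearity of the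
  resulting operators follows from uniqueness of the representer, boundedness from boundedness of
  the form.
\<close>


section \<open>Absolutely continuous functions and integration by parts\<close>

text \<open>Absolute continuity is encoded as being the integral of a given density, so a function
  and its almost-everywhere derivative travel together and pointwise differentiation is avoided.
  Complex values are allowed because the fourth-order equation is solved through one complex
  second-order equation. \<open>R\<close> is continuous although \<open>f''\<close> is only
  square-integrable: both forms pair \<open>f''\<close> with \<open>g\<close>, never with
  \<open>g''\<close>, so it is integrated twice before it enters \<open>R\<close>. Continuity of
  \<open>R\<close> then places \<open>h'' = R + h - z\<close> in L2 at once. The boundary conditions
  are forced by \<open>g'\<close> being free at \<open>a\<close> and \<open>b\<close>. Integrating
  the inner product of \<open>h\<close> and \<open>g\<close> by parts leaves the boundary terms
  \<open>z' g\<close>, \<open>z g'\<close> and \<open>h g'\<close>. The first vanishes through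
  \<open>g\<close>; the other two require \<open>z\<close> and \<open>h\<close> to vanish at the
  ends, and for \<open>h\<close> this is also what membership in \<open>W22\<close> demands.\<close>

definition ac_on :: "real \<Rightarrow> real \<Rightarrow> (real \<Rightarrow> 'a::{euclidean_space, real_normed_field}) \<Rightarrow> (real \<Rightarrow> 'a) \<Rightarrow> bool" where
  "ac_on a b f p \<longleftrightarrow> integrable (lebesgue_on {a..b}) p \<and>
     (\<forall>x\<in>{a..b}. f x - f a = integral\<^sup>L (lebesgue_on {a..x}) p)"

lemma ac_on_eq: "ac_on a b f p \<Longrightarrow> x \<in> {a..b} \<Longrightarrow> f x = f a + integral\<^sup>L (lebesgue_on {a..x}) p"
  unfolding ac_on_def by (metis add.commute diff_add_cancel)

lemma ac_onI:
  assumes "integrable (lebesgue_on {a..b}) p"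
    and "\<And>x. x \<in> {a..b} \<Longrightarrow> f x = f a + integral\<^sup>L (lebesgue_on {a..x}) p"
  shows "ac_on a b f p"
  unfolding ac_on_def using assms(1) assms(2) by (metis add_diff_cancel_left')

lemma ac_on_integrable: "ac_on a b f p \<Longrightarrow> integrable (lebesgue_on {a..b}) p"
  by (simp add: ac_on_def)

lemma ac_on_continuous:
  assumes "ac_on a b f p"
  shows "continuous_on {a..b} f"
proof (rule continuous_on_eq)
  show "continuous_on {a..b} (\<lambda>x. f a + integral\<^sup>L (lebesgue_on {a..x}) p)"
    by (intro continuous_intros indefinite_integral_continuous_real ac_on_integrable[OF assms])
  show "f a + integral\<^sup>L (lebesgue_on {a..x}) p = f x" if "x \<in> {a..b}" for x
    using ac_on_eq[OF assms that] by simp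
qed

lemma integral_lebesgue_on_singleton [simp]:
  "integral\<^sup>L (lebesgue_on {a::real}) (p :: real \<Rightarrow> 'a::euclidean_space) = 0"
proof -
  have "has_bochner_integral (lebesgue_on {a}) p 0"
    by (rule has_bochner_integral_null) auto
  thus ?thesis using has_bochner_integral_integral_eq by blast
qed

lemma ac_on_primitive:
  "integrable (lebesgue_on {a..b}) p \<Longrightarrow> ac_on a b (\<lambda>x. c + integral\<^sup>L (lebesgue_on {a..x}) p) p"
  by (simp add: ac_on_def)

lemma ac_on_cong_AE:
  assumes "ac_on a b f p" and ae: "AE x in lebesgue_on {a..b}. p x = q x"
    and "q \<in> borel_measurable (lebesgue_on {a..b})"
  shows "ac_on a b f q"
proof -
  have p: "integrable (lebesgue_on {a..b}) p" using assms(1) by (rule ac_on_integrable)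
  have q: "integrable (lebesgue_on {a..b}) q"
    by (rule integrable_cong_AE_imp[OF p assms(3)]) (use ae in \<open>auto elim: eventually_mono\<close>)
  have "integral\<^sup>L (lebesgue_on {a..x}) p = integral\<^sup>L (lebesgue_on {a..x}) q" if "x \<in> {a..b}" for x
  proof (rule integral_cong_AE)
    have sub: "{a..x} \<subseteq> {a..b}" using that by auto
    show "p \<in> borel_measurable (lebesgue_on {a..x})" "q \<in> borel_measurable (lebesgue_on {a..x})"
      using integrable_subinterval[OF p sub] integrable_subinterval[OF q sub] by auto
    show "AE y in lebesgue_on {a..x}. p y = q y"
      using ae sub by (auto simp: AE_restrict_space_iff elim!: eventually_mono)
  qed
  with assms(1) q show ?thesis by (simp add: ac_on_def)
qed

lemma ac_on_cong:
  assumes "ac_on a b f p" and "a \<le> b" and "\<And>x. x \<in> {a..b} \<Longrightarrow> f x = g x"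
    and "\<And>x. x \<in> {a..b} \<Longrightarrow> p x = q x"
  shows "ac_on a b g q"
proof -
  have "integrable (lebesgue_on {a..b}) q"
    using ac_on_integrable[OF assms(1)] Bochner_Integration.integrable_cong[OF refl, of "lebesgue_on {a..b}" p q] assms(4) by simp
  moreover have "integral\<^sup>L (lebesgue_on {a..x}) p = integral\<^sup>L (lebesgue_on {a..x}) q" if "x \<in> {a..b}" for x
    using that assms(4) by (intro Bochner_Integration.integral_cong) auto
  moreover have "g x - g a = f x - f a" if "x \<in> {a..b}" for x
    using assms(2) assms(3)[of x] assms(3)[of a] that by simp
  ultimately show ?thesis using assms(1) by (simp add: ac_on_def)
qed

lemma ac_on_const: "ac_on a b (\<lambda>x. c) (\<lambda>x. 0)"
  by (simp add: ac_on_def)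

lemma ac_on_add:
  assumes f: "ac_on a b f p" and g: "ac_on a b g q"
  shows "ac_on a b (\<lambda>x. f x + g x) (\<lambda>x. p x + q x)"
proof (rule ac_onI)
  show "integrable (lebesgue_on {a..b}) (\<lambda>x. p x + q x)"
    by (intro Bochner_Integration.integrable_add ac_on_integrable[OF f] ac_on_integrable[OF g])
  fix x assume x: "x \<in> {a..b}"
  hence sub: "{a..x} \<subseteq> {a..b}" by auto
  have "integral\<^sup>L (lebesgue_on {a..x}) (\<lambda>x. p x + q x) =
      integral\<^sup>L (lebesgue_on {a..x}) p + integral\<^sup>L (lebesgue_on {a..x}) q"
    by (rule Bochner_Integration.integral_add
        [OF integrable_subinterval[OF ac_on_integrable[OF f] sub] integrable_subinterval[OF ac_on_integrable[OF g] sub]])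
  thus "f x + g x = f a + g a + integral\<^sup>L (lebesgue_on {a..x}) (\<lambda>x. p x + q x)"
    using ac_on_eq[OF f x] ac_on_eq[OF g x] by (simp only: ac_simps)
qed

text \<open>A bounded linear map commutes with the integral. The generality serves two purposes:
  multiplication by constants, and passage from a complex solution to the imaginary part of a
  multiple of it.\<close>

lemma ac_on_linear_image:
  assumes f: "ac_on a b f p" and T: "bounded_linear T"
  shows "ac_on a b (\<lambda>x. T (f x)) (\<lambda>x. T (p x))"
proof (rule ac_onI)
  interpret bounded_linear T by fact
  show "integrable (lebesgue_on {a..b}) (\<lambda>x. T (p x))"
    by (rule integrable_bounded_linear[OF T ac_on_integrable[OF f]])
  fix x assume x: "x \<in> {a..b}"
  hence sub: "{a..x} \<subseteq> {a..b}" by auto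
  have "integral\<^sup>L (lebesgue_on {a..x}) (\<lambda>x. T (p x)) = T (integral\<^sup>L (lebesgue_on {a..x}) p)"
    by (rule integral_bounded_linear[OF T integrable_subinterval[OF ac_on_integrable[OF f] sub]])
  thus "T (f x) = T (f a) + integral\<^sup>L (lebesgue_on {a..x}) (\<lambda>x. T (p x))"
    by (simp only: ac_on_eq[OF f x] add)
qed

lemma ac_on_cmult: "ac_on a b f p \<Longrightarrow> ac_on a b (\<lambda>x. c * f x) (\<lambda>x. c * p x)"
  by (erule ac_on_linear_image) (rule bounded_linear_mult_right)

lemma ac_on_of_vector_derivative:
  assumes d: "\<And>x. x \<in> {a..b} \<Longrightarrow> (f has_vector_derivative p x) (at x within {a..b})"
    and c: "continuous_on {a..b} p"
  shows "ac_on a b f p"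
proof -
  have i: "integrable (lebesgue_on {a..b}) p" by (rule continuous_imp_integrable_real[OF c])
  have "f x = f a + integral\<^sup>L (lebesgue_on {a..x}) p" if x: "x \<in> {a..b}" for x
  proof -
    have "(p has_integral (f x - f a)) {a..x}"
      using x by (intro fundamental_theorem_of_calculus) (auto intro: has_vector_derivative_within_subset[OF d])
    moreover have "(p has_integral integral\<^sup>L (lebesgue_on {a..x}) p) {a..x}"
      using x by (intro has_integral_integral_lebesgue_on integrable_subinterval[OF i]) auto
    ultimately show ?thesis by (metis add.commute diff_add_cancel has_integral_unique)
  qed
  with i show ?thesis by (rule ac_onI)
qed

section \<open>Product rule and integration by parts\<close>

lemma integrable_continuous_mult:
  fixes f p :: "real \<Rightarrow> 'a::{euclidean_space, real_normed_field}"
  assumes f: "continuous_on {a..b} f" and p: "integrable (lebesgue_on {a..b}) p"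
  shows "integrable (lebesgue_on {a..b}) (\<lambda>x. f x * p x)"
proof -
  obtain C where C: "\<And>x. x \<in> {a..b} \<Longrightarrow> norm (f x) \<le> C"
    using compact_imp_bounded[OF compact_continuous_image[OF f compact_Icc]] unfolding bounded_iff by fast
  have m: "f \<in> borel_measurable (lebesgue_on {a..b})"
    using continuous_imp_integrable_real[OF f] by auto
  show ?thesis
  proof (rule Bochner_Integration.integrable_bound)
    show "integrable (lebesgue_on {a..b}) (\<lambda>x. C * norm (p x))" using p by simp
    show "(\<lambda>x. f x * p x) \<in> borel_measurable (lebesgue_on {a..b})" using m p by measurable
    show "AE x in lebesgue_on {a..b}. norm (f x * p x) \<le> norm (C * norm (p x))"
    proof (rule AE_I2)
      fix x assume "x \<in> space (lebesgue_on {a..b})"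
      hence "norm (f x) \<le> C" using C by simp
      hence "norm (f x) * norm (p x) \<le> C * norm (p x)" by (simp add: mult_right_mono)
      thus "norm (f x * p x) \<le> norm (C * norm (p x))" by (simp add: norm_mult)
    qed
  qed
qed

lemma integral_primitive_mult:
  fixes p q :: "real \<Rightarrow> 'a::{euclidean_space, real_normed_field}"
  assumes p: "integrable (lebesgue_on {a..b}) p" and q: "integrable (lebesgue_on {a..b}) q"
  defines "P \<equiv> \<lambda>x. integral\<^sup>L (lebesgue_on {a..x}) p"
    and "Q \<equiv> \<lambda>x. integral\<^sup>L (lebesgue_on {a..x}) q"
  shows "integral\<^sup>L (lebesgue_on {a..b}) (\<lambda>x. P x * q x + p x * Q x) = P b * Q b"
proof -
  let ?M = "lebesgue_on {a..b}"
  interpret M: finite_measure ?M by (rule finite_measure_lebesgue_on) auto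
  interpret MM: pair_sigma_finite ?M ?M ..
  have id: "(\<lambda>x::real. x) \<in> borel_measurable ?M"
    using id_borel_measurable_lebesgue_on[of "{a..b}"] by (simp add: id_def)
  have m: "p \<in> borel_measurable ?M" "q \<in> borel_measurable ?M" using p q by auto
  have fm[measurable]: "fst \<in> borel_measurable (?M \<Otimes>\<^sub>M ?M)" "snd \<in> borel_measurable (?M \<Otimes>\<^sub>M ?M)"
    using measurable_compose[OF measurable_fst id] measurable_compose[OF measurable_snd id] by auto
  have pf[measurable]: "(\<lambda>z. p (fst z)) \<in> borel_measurable (?M \<Otimes>\<^sub>M ?M)"
       "(\<lambda>z. q (snd z)) \<in> borel_measurable (?M \<Otimes>\<^sub>M ?M)"
    using measurable_compose[OF measurable_fst m(1)] measurable_compose[OF measurable_snd m(2)] by auto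
  have pq: "integrable (?M \<Otimes>\<^sub>M ?M) (\<lambda>z. p (fst z) * q (snd z))"
  proof (rule MM.Fubini_integrable)
    show "integrable ?M (\<lambda>x. \<integral> y. norm (p (fst (x, y)) * q (snd (x, y))) \<partial>?M)"
      using p q by (simp add: norm_mult)
    show "AE x in ?M. integrable ?M (\<lambda>y. p (fst (x, y)) * q (snd (x, y)))"
      using q by simp
  qed measurable
  \<comment> \<open>The diagonal belongs to \<open>L\<close>, so the two parts add up exactly to the
    full integrand. The price is a half-open interval in the inner integral of \<open>U\<close>,
    repaired below by a null set.\<close>
  define L where "L = (\<lambda>s t. if s \<le> t then p s * q t else 0)"
  define U where "U = (\<lambda>s t. if t < s then p s * q t else 0)"
  have Lm: "case_prod L = (\<lambda>z. if fst z \<le> snd z then p (fst z) * q (snd z) else 0)"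
    and Um: "case_prod U = (\<lambda>z. if snd z < fst z then p (fst z) * q (snd z) else 0)"
    by (auto simp: L_def U_def fun_eq_iff)
  have Li: "integrable (?M \<Otimes>\<^sub>M ?M) (case_prod L)" and Ui: "integrable (?M \<Otimes>\<^sub>M ?M) (case_prod U)"
    unfolding Lm Um by (rule Bochner_Integration.integrable_bound[OF pq]; (measurable; auto))+
  have inner1: "(\<integral>s. L s t \<partial>?M) = P t * q t" if "t \<in> {a..b}" for t
  proof -
    have "(\<integral>s. L s t \<partial>?M) = (\<integral>s. (if s \<in> {a..t} then p s else 0) * q t \<partial>?M)"
      by (rule Bochner_Integration.integral_cong) (auto simp: L_def)
    also have "\<dots> = (\<integral>s. (if s \<in> {a..t} then p s else 0) \<partial>?M) * q t"
      by simp
    also have "(\<integral>s. (if s \<in> {a..t} then p s else 0) \<partial>?M) = P t"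
      unfolding P_def using that by (intro integral_restrict) auto
    finally show ?thesis .
  qed
  have inner2: "(\<integral>t. U s t \<partial>?M) = p s * Q s" if s: "s \<in> {a..b}" for s
  proof -
    have "(\<integral>t. U s t \<partial>?M) = (\<integral>t. p s * (if t \<in> {a..<s} then q t else 0) \<partial>?M)"
      by (rule Bochner_Integration.integral_cong) (auto simp: U_def)
    also have "\<dots> = p s * (\<integral>t. (if t \<in> {a..<s} then q t else 0) \<partial>?M)"
      by simp
    also have "(\<integral>t. (if t \<in> {a..<s} then q t else 0) \<partial>?M) = (\<integral>t. (if t \<in> {a..s} then q t else 0) \<partial>?M)"
    proof (rule integral_cong_AE)
      show "(\<lambda>t. if t \<in> {a..<s} then q t else 0) \<in> borel_measurable ?M"
           "(\<lambda>t. if t \<in> {a..s} then q t else 0) \<in> borel_measurable ?M"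
        using m id by measurable
      have "AE t in lebesgue. t \<noteq> s" by (rule AE_completion, rule AE_lborel_singleton)
      hence "AE t in ?M. t \<noteq> s" by (auto simp: AE_restrict_space_iff elim: eventually_mono)
      thus "AE t in ?M. (if t \<in> {a..<s} then q t else 0) = (if t \<in> {a..s} then q t else 0)"
        by (rule eventually_mono) auto
    qed
    also have "\<dots> = Q s"
      unfolding Q_def using s by (intro integral_restrict) auto
    finally show ?thesis .
  qed
  have "(\<integral>t. (\<integral>s. L s t \<partial>?M) \<partial>?M) = integral\<^sup>L (?M \<Otimes>\<^sub>M ?M) (case_prod L)"
    by (rule MM.integral_snd[OF Li])
  moreover have "(\<integral>s. (\<integral>t. U s t \<partial>?M) \<partial>?M) = integral\<^sup>L (?M \<Otimes>\<^sub>M ?M) (case_prod U)"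
    by (rule MM.integral_fst[OF Ui])
  moreover have "integral\<^sup>L (?M \<Otimes>\<^sub>M ?M) (case_prod L) + integral\<^sup>L (?M \<Otimes>\<^sub>M ?M) (case_prod U) =
      integral\<^sup>L (?M \<Otimes>\<^sub>M ?M) (\<lambda>z. p (fst z) * q (snd z))"
    unfolding Bochner_Integration.integral_add[OF Li Ui, symmetric]
    by (rule Bochner_Integration.integral_cong) (auto simp: L_def U_def)
  moreover have "integral\<^sup>L (?M \<Otimes>\<^sub>M ?M) (\<lambda>z. p (fst z) * q (snd z)) = P b * Q b"
    using MM.integral_fst'[OF pq] by (simp add: P_def Q_def)
  moreover have "(\<integral>t. (\<integral>s. L s t \<partial>?M) \<partial>?M) = (\<integral>t. P t * q t \<partial>?M)"
    by (rule Bochner_Integration.integral_cong) (auto simp: inner1)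
  moreover have "(\<integral>s. (\<integral>t. U s t \<partial>?M) \<partial>?M) = (\<integral>t. p t * Q t \<partial>?M)"
    by (rule Bochner_Integration.integral_cong) (auto simp: inner2)
  moreover have "integrable ?M (\<lambda>t. P t * q t)"
    unfolding P_def by (rule integrable_continuous_mult[OF indefinite_integral_continuous_real[OF p] q])
  moreover have "integrable ?M (\<lambda>t. p t * Q t)"
    unfolding Q_def using integrable_continuous_mult[OF indefinite_integral_continuous_real[OF q] p] by (simp add: mult.commute)
  ultimately show ?thesis by simp
qed

text \<open>Writing \<open>f = f a + P\<close> and \<open>g = g a + Q\<close> on the interval, all
  products but \<open>P * Q\<close> involve a constant, and \<open>P * Q\<close> is the case settled
  by Fubini.\<close>

lemma ac_on_mult:
  assumes f: "ac_on a b f p" and g: "ac_on a b g q"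
  shows "ac_on a b (\<lambda>x. f x * g x) (\<lambda>x. f x * q x + p x * g x)"
proof -
  have p: "integrable (lebesgue_on {a..b}) p" and q: "integrable (lebesgue_on {a..b}) q"
    using f g by (auto simp: ac_on_def)
  have i: "integrable (lebesgue_on {a..b}) (\<lambda>x. f x * q x + p x * g x)"
    using integrable_continuous_mult[OF ac_on_continuous[OF f] q]
      integrable_continuous_mult[OF ac_on_continuous[OF g] p] by (simp add: mult.commute)
  have "f x * g x = f a * g a + integral\<^sup>L (lebesgue_on {a..x}) (\<lambda>x. f x * q x + p x * g x)"
    if x: "x \<in> {a..b}" for x
  proof -
    let ?M = "lebesgue_on {a..x}"
    define P where "P = (\<lambda>x. integral\<^sup>L (lebesgue_on {a..x}) p)"
    define Q where "Q = (\<lambda>x. integral\<^sup>L (lebesgue_on {a..x}) q)"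
    have sub: "{a..x} \<subseteq> {a..b}" using x by auto
    have p': "integrable ?M p" and q': "integrable ?M q"
      using integrable_subinterval[OF _ sub] p q by auto
    have fP: "f y = f a + P y" and gQ: "g y = g a + Q y" if "y \<in> {a..b}" for y
      using ac_on_eq[OF f that] ac_on_eq[OF g that] unfolding P_def Q_def by blast+
    have Pq: "integrable ?M (\<lambda>t. P t * q t)" and pQ: "integrable ?M (\<lambda>t. p t * Q t)"
      unfolding P_def Q_def
      using integrable_continuous_mult[OF indefinite_integral_continuous_real[OF p'] q']
        integrable_continuous_mult[OF indefinite_integral_continuous_real[OF q'] p'] by (simp_all add: mult.commute)
    have "integral\<^sup>L ?M (\<lambda>x. f x * q x + p x * g x) =
       integral\<^sup>L ?M (\<lambda>t. (f a * q t + p t * g a) + (P t * q t + p t * Q t))"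
    proof (rule Bochner_Integration.integral_cong)
      fix t assume "t \<in> space ?M"
      hence t: "t \<in> {a..b}" using x by auto
      show "f t * q t + p t * g t = (f a * q t + p t * g a) + (P t * q t + p t * Q t)"
        unfolding fP[OF t] gQ[OF t] by (simp only: algebra_simps)
    qed simp
    also have "\<dots> = f a * Q x + P x * g a + P x * Q x"
      using p' q' Pq pQ integral_primitive_mult[OF p' q']
      by (simp add: P_def Q_def)
    finally show ?thesis unfolding fP[OF x] gQ[OF x] by (simp only: algebra_simps)
  qed
  with i show ?thesis by (rule ac_onI)
qed

lemma integral_by_parts_ac:
  assumes f: "ac_on a b f p" and g: "ac_on a b g q" and "a \<le> b"
  shows "integral\<^sup>L (lebesgue_on {a..b}) (\<lambda>x. f x * q x) =
     f b * g b - f a * g a - integral\<^sup>L (lebesgue_on {a..b}) (\<lambda>x. p x * g x)"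
proof -
  have p: "integrable (lebesgue_on {a..b}) p" and q: "integrable (lebesgue_on {a..b}) q"
    using f g by (auto simp: ac_on_def)
  have "f b * g b = f a * g a + integral\<^sup>L (lebesgue_on {a..b}) (\<lambda>x. f x * q x + p x * g x)"
    using ac_on_eq[OF ac_on_mult[OF f g], of b] \<open>a \<le> b\<close> by simp
  moreover have "integrable (lebesgue_on {a..b}) (\<lambda>x. f x * q x)" "integrable (lebesgue_on {a..b}) (\<lambda>x. p x * g x)"
    using integrable_continuous_mult[OF ac_on_continuous[OF f] q]
      integrable_continuous_mult[OF ac_on_continuous[OF g] p] by (simp_all add: mult.commute)
  ultimately show ?thesis by simp
qed

section \<open>Smooth bump functions\<close>

text \<open>Test functions are defined through \<open>deriv ^^ n\<close>. This recursion peels off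
  the innermost derivative first, so that sums, products and affine substitutions can be treated by
  induction on \<open>n\<close> with the functions arbitrary.\<close>

primrec differentiable_times :: "nat \<Rightarrow> (real \<Rightarrow> real) \<Rightarrow> bool" where
  "differentiable_times 0 f \<longleftrightarrow> True"
| "differentiable_times (Suc n) f \<longleftrightarrow> (\<forall>x. f differentiable at x) \<and> differentiable_times n (deriv f)"

lemma all_differentiable_iff:
  "(\<forall>n x. (deriv ^^ n) f differentiable at x) \<longleftrightarrow> (\<forall>n. differentiable_times n f)"
proof -
  \<comment> \<open>The equivalence can be proved by induction only in its bounded form; quantifying
    over all \<open>n\<close> afterwards recovers the claim.\<close>
  have "(\<forall>k<n. \<forall>x. (deriv ^^ k) f differentiable at x) \<longleftrightarrow> differentiable_times n f" for n
  proof (induction n arbitrary: f)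
    case (Suc n)
    have "(\<forall>k<Suc n. \<forall>x. (deriv ^^ k) f differentiable at x) \<longleftrightarrow>
       (\<forall>x. f differentiable at x) \<and> (\<forall>k<n. \<forall>x. (deriv ^^ k) (deriv f) differentiable at x)"
      by (simp add: All_less_Suc2 funpow_Suc_right del: funpow.simps(2))
    with Suc show ?case by simp
  qed simp
  thus ?thesis by (metis lessI)
qed

lemma differentiable_times_Suc_imp: "differentiable_times (Suc n) f \<Longrightarrow> differentiable_times n f"
  by (induction n arbitrary: f) simp_all

lemma differentiable_timesI:
  assumes "\<And>x. (f has_real_derivative f' x) (at x)" and "differentiable_times n f'"
  shows "differentiable_times (Suc n) f"
proof -
  have "deriv f = f'" using assms(1) by (intro ext DERIV_imp_deriv)
  with assms show ?thesis by (auto simp: real_differentiable_def)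
qed

lemma differentiable_timesD:
  "differentiable_times (Suc n) f \<Longrightarrow> (f has_real_derivative deriv f x) (at x)"
  by (simp add: DERIV_deriv_iff_real_differentiable)

lemma differentiable_times_add:
  "differentiable_times n f \<Longrightarrow> differentiable_times n g \<Longrightarrow> differentiable_times n (\<lambda>x. f x + g x)"
proof (induction n arbitrary: f g)
  case (Suc n)
  have "differentiable_times n (\<lambda>x. deriv f x + deriv g x)" using Suc by simp
  thus ?case
    by (rule differentiable_timesI[rotated]) (intro DERIV_add differentiable_timesD[OF Suc.prems(1)] differentiable_timesD[OF Suc.prems(2)])
qed simp

lemma differentiable_times_mult:
  "differentiable_times n f \<Longrightarrow> differentiable_times n g \<Longrightarrow> differentiable_times n (\<lambda>x. f x * g x)"
proof (induction n arbitrary: f g)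
  case (Suc n)
  have "differentiable_times n (\<lambda>x. deriv f x * g x + deriv g x * f x)"
    using Suc.prems differentiable_times_Suc_imp[OF Suc.prems(1)] differentiable_times_Suc_imp[OF Suc.prems(2)]
    by (intro differentiable_times_add Suc.IH) simp_all
  thus ?case
    by (rule differentiable_timesI[rotated]) (intro DERIV_mult differentiable_timesD[OF Suc.prems(1)] differentiable_timesD[OF Suc.prems(2)])
qed simp

lemma differentiable_times_const: "differentiable_times n (\<lambda>x. c)"
proof (induction n arbitrary: c)
  case (Suc n)
  show ?case by (rule differentiable_timesI[OF DERIV_const Suc.IH])
qed simp

lemma differentiable_times_affine:
  "differentiable_times n f \<Longrightarrow> differentiable_times n (\<lambda>x. f (c * x + d))"
proof (induction n arbitrary: f)
  case (Suc n)
  have "differentiable_times n (\<lambda>x. deriv f (c * x + d) * c)"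
    using Suc by (intro differentiable_times_mult differentiable_times_const) simp
  moreover have "((\<lambda>x. f (c * x + d)) has_real_derivative deriv f (c * x + d) * c) (at x)" for x
    by (rule DERIV_chain'[where f = "\<lambda>x. c * x + d" and g = f, THEN DERIV_cong])
       (auto intro!: derivative_eq_intros differentiable_timesD[OF Suc.prems])
  ultimately show ?case by (intro differentiable_timesI)
qed simp

text \<open>
  Differentiating \<open>p(1/x) exp(-1/x)\<close> only replaces the polynomial \<open>p\<close> by \<open>X\<^sup>2 (p - p')\<close>, which
  gives smoothness by induction for all \<open>p\<close> at once.
\<close>

definition exp_inv :: "real poly \<Rightarrow> real \<Rightarrow> real" where
  "exp_inv p x = (if x > 0 then poly p (inverse x) * exp (- inverse x) else 0)"

lemma poly_over_exp_tendsto_0: "((\<lambda>x::real. poly p x * exp (- x)) \<longlongrightarrow> 0) at_top"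
proof (induction p rule: pCons_induct)
  case (pCons c p)
  have *: "((\<lambda>x. x ^ k * exp (- x)) \<longlongrightarrow> (0::real)) at_top" for k
    using tendsto_power_div_exp_0[of k] by (simp add: exp_minus divide_inverse)
  have "((\<lambda>x. c * (x ^ 0 * exp (- x)) + (\<Sum>i\<le>degree p. coeff p i * (x ^ Suc i * exp (- x)))) \<longlongrightarrow> c * 0 + (\<Sum>i\<le>degree p. coeff p i * 0)) at_top"
    by (intro tendsto_intros *)
  moreover have "c * (x ^ 0 * exp (- x)) + (\<Sum>i\<le>degree p. coeff p i * (x ^ Suc i * exp (- x))) = poly (pCons c p) x * exp (- x)" for x
    by (simp add: poly_altdef[of p] sum_distrib_left sum_distrib_right algebra_simps)
  ultimately show ?case by simp
qed simp

lemma exp_inv_has_derivative: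
  "(exp_inv p has_real_derivative exp_inv ([:0, 0, 1:] * (p - pderiv p)) x) (at x)"
proof (cases x "0 :: real" rule: linorder_cases)
  case less
  have "eventually (\<lambda>y. y < 0) (nhds x)" using less eventually_nhds_in_open[of "{..<0}" x] by simp
  hence "eventually (\<lambda>y. exp_inv p y = 0) (nhds x)" by eventually_elim (simp add: exp_inv_def)
  with less show ?thesis
    by (subst DERIV_cong_ev[OF refl _ refl]) (auto simp: exp_inv_def)
next
  case greater
  have "eventually (\<lambda>y. y > 0) (nhds x)" using greater eventually_nhds_in_open[of "{0<..}" x] by simp
  hence "eventually (\<lambda>y. exp_inv p y = poly p (inverse y) * exp (- inverse y)) (nhds x)"
    by eventually_elim (simp add: exp_inv_def)
  moreover have "((\<lambda>y. poly p (inverse y) * exp (- inverse y)) has_real_derivative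
     exp_inv ([:0, 0, 1:] * (p - pderiv p)) x) (at x)"
    using greater
    by (auto intro!: derivative_eq_intros poly_DERIV[THEN DERIV_chain2] simp: exp_inv_def field_simps power2_eq_square)
  ultimately show ?thesis
    by (subst DERIV_cong_ev[OF refl _ refl]) auto
next
  case equal
  \<comment> \<open>Dividing by \<open>h\<close> multiplies the polynomial in \<open>1/h\<close> by
    its variable, that is, turns \<open>p\<close> into \<open>pCons 0 p\<close>. The difference
    quotient at 0 is therefore of the same kind, and the exponential beats it.\<close>
  have "((\<lambda>h. poly (pCons 0 p) (inverse h) * exp (- inverse h)) \<longlongrightarrow> 0) (at_right 0)"
    by (rule filterlim_compose[OF poly_over_exp_tendsto_0 filterlim_inverse_at_top_right])
  hence "((\<lambda>h. exp_inv p h / h) \<longlongrightarrow> 0) (at_right 0)"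
    by (rule Lim_transform_eventually)
       (auto simp: eventually_at_right_less exp_inv_def divide_inverse mult_ac intro!: eventually_mono[OF eventually_at_right_less])
  moreover have "((\<lambda>h. exp_inv p h / h) \<longlongrightarrow> 0) (at_left 0)"
    by (rule Lim_transform_eventually[OF tendsto_const])
       (auto simp: exp_inv_def eventually_at_left_field intro!: exI[of _ "-1"])
  ultimately have "((\<lambda>h. exp_inv p h / h) \<longlongrightarrow> 0) (at 0)"
    by (simp add: filterlim_split_at)
  thus ?thesis using equal by (simp add: DERIV_def exp_inv_def)
qed

lemma differentiable_times_exp_inv: "differentiable_times n (exp_inv p)"
proof (induction n arbitrary: p)
  case (Suc n)
  show ?case by (rule differentiable_timesI[OF exp_inv_has_derivative Suc.IH])
qed simp

text \<open>A product of two one-sided functions \<open>exp (-1/x)\<close>, one flat at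
  \<open>c\<close> and one at \<open>d\<close>. The factor \<open>n\<close> only steepens the
  flanks: the support stays in \<open>{c..d}\<close>, the values stay in the unit interval, and the
  limit is the indicator of the open interval.\<close>

definition bump :: "real \<Rightarrow> real \<Rightarrow> nat \<Rightarrow> real \<Rightarrow> real" where
  "bump c d n x = exp_inv 1 (real n * x + (- real n * c)) * exp_inv 1 (- real n * x + real n * d)"

lemma bump_test_function:
  assumes "a < c" "d < b"
  shows "bump c d n \<in> test_functions a b"
proof -
  have "differentiable_times k (bump c d n)" for k
    unfolding bump_def by (intro differentiable_times_mult differentiable_times_affine differentiable_times_exp_inv)
  moreover have "bump c d n x = 0" if "x \<notin> {c..d}" for x
  proof (cases "x < c")
    case True
    hence "real n * x \<le> real n * c" by (intro mult_left_mono) auto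
    thus ?thesis by (simp add: bump_def exp_inv_def)
  next
    case False
    with that have "real n * d \<le> real n * x" by (intro mult_left_mono) auto
    thus ?thesis by (simp add: bump_def exp_inv_def)
  qed
  ultimately show ?thesis using assms unfolding test_functions_def all_differentiable_iff by blast
qed

lemma bump_bounds: "0 \<le> bump c d n x" "bump c d n x \<le> 1"
  by (auto simp: bump_def exp_inv_def intro!: mult_le_one)

lemma bump_tendsto_indicator:
  "(\<lambda>n. bump c d n x) \<longlonglongrightarrow> indicator {c<..<d} x"
proof (cases "x \<in> {c<..<d}")
  case True
  have lim: "(\<lambda>n. exp_inv 1 (real n * r)) \<longlonglongrightarrow> 1" if "r > 0" for r
  proof -
    have "(\<lambda>n. exp (- (inverse (real n) * inverse r))) \<longlonglongrightarrow> exp (- (0 * inverse r))"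
      by (intro tendsto_intros lim_inverse_n)
    hence "(\<lambda>n. exp (- (inverse (real n) * inverse r))) \<longlonglongrightarrow> 1" by simp
    thus ?thesis
      by (rule Lim_transform_eventually)
         (use that in \<open>auto simp: exp_inv_def intro!: eventually_mono[OF eventually_gt_at_top[of 0]]\<close>)
  qed
  have "(\<lambda>n. exp_inv 1 (real n * (x - c)) * exp_inv 1 (real n * (d - x))) \<longlonglongrightarrow> 1 * 1"
    using True by (intro tendsto_mult lim) auto
  with True show ?thesis by (simp add: bump_def algebra_simps)
next
  case False
  have "bump c d n x = 0" for n
  proof (cases "x \<le> c")
    case True
    hence "real n * x \<le> real n * c" by (intro mult_left_mono) auto
    thus ?thesis by (simp add: bump_def exp_inv_def)
  next
    case nc: False
    with False have "real n * d \<le> real n * x" by (intro mult_left_mono) auto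
    thus ?thesis by (simp add: bump_def exp_inv_def)
  qed
  with False show ?thesis by simp
qed

section \<open>The lemma of du Bois-Reymond\<close>

text \<open>Lebesgue differentiation: at almost every interior point \<open>g x\<close> is the limit
  of its averages over \<open>{x..x + h}\<close>, and for small \<open>h\<close> these averages are
  zero.\<close>

lemma AE_eq_0_of_intervals:
  fixes g :: "real \<Rightarrow> real"
  assumes g: "integrable (lebesgue_on {a..b}) g"
    and z: "\<And>c d. a < c \<Longrightarrow> c < d \<Longrightarrow> d < b \<Longrightarrow> integral\<^sup>L (lebesgue_on {c..d}) g = 0"
  shows "AE x in lebesgue_on {a..b}. g x = 0"
proof -
  \<comment> \<open>The differentiation theorem asks for integrability on every interval of the
    line, hence the extension by zero.\<close>
  define G where "G = (\<lambda>x. if x \<in> {a..b} then g x else 0)"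
  have "g absolutely_integrable_on {a..b}"
    using g by (simp add: integrable_restrict_space set_integrable_def)
  hence "G absolutely_integrable_on UNIV"
    unfolding G_def using absolutely_integrable_restrict_UNIV by blast
  hence "G integrable_on cbox c d" for c d
    by (metis absolutely_integrable_on_def integrable_on_subcbox subset_UNIV)
  then obtain N where N: "negligible N" and
    lim: "\<And>x e. x \<notin> N \<Longrightarrow> 0 < e \<Longrightarrow> \<exists>d>0. \<forall>h. 0 < h \<and> h < d \<longrightarrow>
        norm (integral (cbox x (x + h *\<^sub>R One)) G /\<^sub>R h ^ DIM(real) - G x) < e"
    by (rule integrable_ccontinuous_explicit[of G]) blast+
  have "g x = 0" if x: "x \<notin> N" "a < x" "x < b" for x
  proof (rule ccontr)
    assume "g x \<noteq> 0"
    then obtain d where "d > 0" and d: "\<And>h. 0 < h \<Longrightarrow> h < d \<Longrightarrow>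
        norm (integral (cbox x (x + h *\<^sub>R One)) G /\<^sub>R h ^ DIM(real) - G x) < \<bar>g x\<bar>"
      using lim[OF x(1), of "\<bar>g x\<bar>"] by auto
    define h where "h = min (d / 2) ((b - x) / 2)"
    have h: "0 < h" "h < d" "x + h < b" using \<open>d > 0\<close> x by (auto simp: h_def min_def field_simps)
    have "integral {x..x + h} G = integral {x..x + h} g"
      using h x by (intro Henstock_Kurzweil_Integration.integral_cong) (auto simp: G_def)
    also have "\<dots> = integral\<^sup>L (lebesgue_on {x..x + h}) g"
      using h x by (intro lebesgue_integral_eq_integral[symmetric] integrable_subinterval[OF g]) auto
    also have "\<dots> = 0" using z[of x "x + h"] h x by simp
    finally show False using d[OF h(1,2)] x by (simp add: G_def)
  qed
  moreover have "N \<union> {a, b} \<in> null_sets lebesgue"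
    using N by (simp add: negligible_iff_null_sets)
  ultimately have "AE x in lebesgue. x \<in> {a..b} \<longrightarrow> g x = 0"
    by (intro AE_I'[of "N \<union> {a, b}"]) force+
  thus ?thesis by (simp add: AE_restrict_space_iff)
qed

lemma test_function_continuous: "\<phi> \<in> test_functions a b \<Longrightarrow> continuous_on S \<phi>"
proof -
  assume "\<phi> \<in> test_functions a b"
  hence "\<phi> differentiable at x" for x
    unfolding test_functions_def by (auto dest: spec[of _ 0])
  thus ?thesis by (meson continuous_at_imp_continuous_on differentiable_imp_continuous_within)
qed

text \<open>Bumps converge pointwise to the indicator of an inner interval, and the products are
  dominated by the absolute value of \<open>g\<close>. So \<open>g\<close> has zero integral over
  each inner interval.\<close>

lemma fundamental_lemma:
  assumes g: "integrable (lebesgue_on {a..b}) g"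
    and z: "\<And>\<phi>. \<phi> \<in> test_functions a b \<Longrightarrow> integral\<^sup>L (lebesgue_on {a..b}) (\<lambda>x. g x * \<phi> x) = 0"
  shows "AE x in lebesgue_on {a..b}. g x = 0"
proof (rule AE_eq_0_of_intervals[OF g])
  fix c d assume cd: "a < c" "c < d" "d < b"
  let ?M = "lebesgue_on {a..b}"
  have t: "bump c d n \<in> test_functions a b" for n by (rule bump_test_function) (use cd in auto)
  have "(\<lambda>n. integral\<^sup>L ?M (\<lambda>x. g x * bump c d n x)) \<longlonglongrightarrow> integral\<^sup>L ?M (\<lambda>x. g x * indicator {c<..<d} x)"
  proof (rule integral_dominated_convergence)
    show "integrable ?M (\<lambda>x. norm (g x))" using g by simp
    show "(\<lambda>x. g x * indicator {c<..<d} x) \<in> borel_measurable ?M"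
    proof -
      have [measurable]: "(\<lambda>x::real. x) \<in> borel_measurable ?M"
        using id_borel_measurable_lebesgue_on[of "{a..b}"] by (simp add: id_def)
      have [measurable]: "g \<in> borel_measurable ?M" using g by auto
      have "(\<lambda>x. g x * (if c < x \<and> x < d then 1 else 0)) \<in> borel_measurable ?M" by measurable
      thus ?thesis by (simp add: indicator_def)
    qed
    show "(\<lambda>x. g x * bump c d n x) \<in> borel_measurable ?M" for n
      using integrable_continuous_mult[OF test_function_continuous[OF t] g]
      by (intro borel_measurable_integrable) (simp add: mult.commute)
    show "AE x in ?M. (\<lambda>n. g x * bump c d n x) \<longlonglongrightarrow> g x * indicator {c<..<d} x"
      by (intro AE_I2 tendsto_intros bump_tendsto_indicator)
    show "AE x in ?M. norm (g x * bump c d n x) \<le> norm (g x)" for n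
      by (intro AE_I2) (simp add: abs_mult bump_bounds mult_left_le)
  qed
  hence "(\<lambda>n. 0) \<longlonglongrightarrow> integral\<^sup>L ?M (\<lambda>x. g x * indicator {c<..<d} x)"
    by (simp only: z[OF t])
  hence "integral\<^sup>L ?M (\<lambda>x. g x * indicator {c<..<d} x) = 0" by (simp add: LIMSEQ_const_iff)
  moreover have "integral\<^sup>L ?M (\<lambda>x. g x * indicator {c<..<d} x) = integral\<^sup>L ?M (\<lambda>x. if x \<in> {c..d} then g x else 0)"
  proof (rule integral_cong_AE)
    have [measurable]: "(\<lambda>x::real. x) \<in> borel_measurable ?M"
      using id_borel_measurable_lebesgue_on[of "{a..b}"] by (simp add: id_def)
    have [measurable]: "g \<in> borel_measurable ?M" using g by auto
    have "(\<lambda>x. g x * (if c < x \<and> x < d then 1 else 0)) \<in> borel_measurable ?M" by measurable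
    thus "(\<lambda>x. g x * indicator {c<..<d} x) \<in> borel_measurable ?M" by (simp add: indicator_def)
    have "(\<lambda>x. if c \<le> x \<and> x \<le> d then g x else 0) \<in> borel_measurable ?M" by measurable
    thus "(\<lambda>x. if x \<in> {c..d} then g x else 0) \<in> borel_measurable ?M" by simp
    have "AE x in lebesgue. x \<noteq> c \<and> x \<noteq> d"
      by (intro AE_conjI AE_completion AE_lborel_singleton)
    hence "AE x in ?M. x \<noteq> c \<and> x \<noteq> d" by (auto simp: AE_restrict_space_iff elim: eventually_mono)
    thus "AE x in ?M. g x * indicator {c<..<d} x = (if x \<in> {c..d} then g x else 0)"
      by (rule eventually_mono) (auto simp: indicator_def)
  qed
  moreover have "\<dots> = integral\<^sup>L (lebesgue_on {c..d}) g"
    using cd by (intro integral_restrict) auto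
  ultimately show "integral\<^sup>L (lebesgue_on {c..d}) g = 0" by simp
qed

lemma test_function_ac:
  assumes "\<phi> \<in> test_functions a b"
  shows "ac_on a b \<phi> (deriv \<phi>)" "\<phi> a = 0" "\<phi> b = 0"
proof -
  have d: "\<phi> differentiable at x" "deriv \<phi> differentiable at x" for x
    using assms unfolding test_functions_def by (auto dest: spec[of _ 0] spec[of _ "Suc 0"])
  show "ac_on a b \<phi> (deriv \<phi>)"
  proof (rule ac_on_of_vector_derivative)
    show "(\<phi> has_vector_derivative deriv \<phi> x) (at x within {a..b})" for x
      using d(1)[of x] by (metis DERIV_deriv_iff_real_differentiable has_field_derivative_at_within
        has_real_derivative_iff_has_vector_derivative)
    show "continuous_on {a..b} (deriv \<phi>)"
      using d(2) by (meson continuous_at_imp_continuous_on differentiable_imp_continuous_within)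
  qed
  show "\<phi> a = 0" "\<phi> b = 0" using assms unfolding test_functions_def by fastforce+
qed

lemma ac_on_weak_derivative:
  assumes "ac_on a b f p" "a \<le> b" "\<phi> \<in> test_functions a b"
  shows "integral\<^sup>L (lebesgue_on {a..b}) (\<lambda>x. f x * deriv \<phi> x) = - integral\<^sup>L (lebesgue_on {a..b}) (\<lambda>x. p x * \<phi> x)"
  using integral_by_parts_ac[OF assms(1) test_function_ac(1)[OF assms(3)] assms(2)]
    test_function_ac(2,3)[OF assms(3)] by simp

lemma test_functions_combination:
  assumes "\<phi> \<in> test_functions a b" "\<psi> \<in> test_functions a b"
  shows "(\<lambda>x. \<phi> x + c * \<psi> x) \<in> test_functions a b"
proof -
  from assms obtain d e d' e' where
    *: "a < d" "e < b" "\<forall>x. x \<notin> {d..e} \<longrightarrow> \<phi> x = 0" "a < d'" "e' < b" "\<forall>x. x \<notin> {d'..e'} \<longrightarrow> \<psi> x = 0"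
    unfolding test_functions_def by blast
  have "\<phi> x + c * \<psi> x = 0" if "x \<notin> {min d d'..max e e'}" for x
  proof -
    have "x \<notin> {d..e}" "x \<notin> {d'..e'}" using that by auto
    thus ?thesis using * by simp
  qed
  moreover have "a < min d d'" "max e e' < b" using * by auto
  moreover have "differentiable_times n (\<lambda>x. \<phi> x + c * \<psi> x)" for n
    using assms unfolding test_functions_def all_differentiable_iff
    by (auto intro!: differentiable_times_add differentiable_times_mult differentiable_times_const)
  ultimately show ?thesis unfolding test_functions_def all_differentiable_iff by blast
qed

text \<open>Mean zero is what makes the primitive return to 0 to the right of the support, so that
  it is compactly supported again.\<close>

lemma test_function_primitive:
  assumes ab: "a < b" and \<phi>: "\<phi> \<in> test_functions a b" and z: "integral\<^sup>L (lebesgue_on {a..b}) \<phi> = 0"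
  obtains \<Phi> where "\<Phi> \<in> test_functions a b" "deriv \<Phi> = \<phi>"
proof -
  from \<phi> obtain c d where cd: "a < c" "d < b" "\<forall>x. x \<notin> {c..d} \<longrightarrow> \<phi> x = 0"
    unfolding test_functions_def by blast
  have cont: "continuous_on S \<phi>" for S by (rule test_function_continuous[OF \<phi>])
  have prim: "integral {a - 1..x} \<phi> = integral {a - 1..y} \<phi> + integral {y..x} \<phi>" if "a - 1 \<le> y" "y \<le> x" for x y
    using that by (intro Henstock_Kurzweil_Integration.integral_combine[symmetric] integrable_continuous_real cont)
  \<comment> \<open>Starting the integral at \<open>a - 1\<close> leaves room on the left, so that
    every \<open>x \<ge> a\<close> is interior to the interval on which the derivative is computed.
    The two branches agree on \<open>{a - 1..<a}\<close>, where \<open>\<phi>\<close>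
    vanishes.\<close>
  define \<Phi> where "\<Phi> = (\<lambda>x. if x < a then 0 else integral {a - 1..x} \<phi>)"
  have zero: "integral {u..v} \<phi> = 0" if "v < c \<or> d < u" for u v
    by (rule trans[OF Henstock_Kurzweil_Integration.integral_cong[where g = "\<lambda>x. 0"]])
       (use that cd in auto)
  have ab0: "integral {a..b} \<phi> = 0"
    using z lebesgue_integral_eq_integral[OF continuous_imp_integrable_real[OF cont]] by simp
  \<comment> \<open>Nothing prevents \<open>d < a\<close>, in which case \<open>{c..d}\<close> is
    empty; \<open>max d a\<close> is a right bound for the support that is still below
    \<open>b\<close>.\<close>
  have \<Phi>0: "\<Phi> x = 0" if "x \<notin> {c..d'}" "d' = max d a" for x d'
  proof (cases "x < c")
    case True
    thus ?thesis using zero[of x "a - 1"] by (simp add: \<Phi>_def)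
  next
    case False
    with that cd have x: "d < x" "a < x" by auto
    show ?thesis
    proof (cases "x \<le> b")
      case True
      have "integral {a - 1..b} \<phi> = 0" using prim[of a b] zero[of a "a - 1"] cd ab0 ab by simp
      thus ?thesis using prim[of x b] zero[of b x] True x by (simp add: \<Phi>_def)
    next
      case False
      have "integral {a - 1..b} \<phi> = 0" using prim[of a b] zero[of a "a - 1"] cd ab0 ab by simp
      thus ?thesis using prim[of b x] zero[of x b] False x cd ab by (simp add: \<Phi>_def)
    qed
  qed
  have der: "(\<Phi> has_real_derivative \<phi> x) (at x)" for x
  proof (cases "x < a")
    case True
    have "eventually (\<lambda>y. \<Phi> y = 0) (nhds x)"
      using True eventually_nhds_in_open[of "{..<a}" x] by (auto simp: \<Phi>_def elim: eventually_mono)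
    moreover have "\<phi> x = 0" using True cd by auto
    ultimately show ?thesis by (subst DERIV_cong_ev[OF refl _ refl]) auto
  next
    case False
    have "((\<lambda>y. integral {a - 1..y} \<phi>) has_real_derivative \<phi> x) (at x within {a - 1..x + 1})"
      by (rule integral_has_real_derivative[OF cont]) (use False in auto)
    moreover have "at x within {a - 1..x + 1} = at x"
      using False by (intro at_within_interior) auto
    moreover have "eventually (\<lambda>y. \<Phi> y = integral {a - 1..y} \<phi>) (nhds x)"
    proof -
      have "eventually (\<lambda>y. y \<in> {a - 1<..}) (nhds x)"
        using False by (intro eventually_nhds_in_open) auto
      thus ?thesis
      proof eventually_elim
        case (elim y)
        thus ?case using zero[of y "a - 1"] cd by (auto simp: \<Phi>_def)
      qed
    qed
    ultimately show ?thesis by (subst DERIV_cong_ev[OF refl _ refl]) auto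
  qed
  have d: "deriv \<Phi> = \<phi>" by (intro ext DERIV_imp_deriv der)
  have "differentiable_times n \<Phi>" for n
  proof (cases n)
    case (Suc m)
    have "differentiable_times m \<phi>" using \<phi> unfolding test_functions_def all_differentiable_iff by blast
    thus ?thesis unfolding Suc by (rule differentiable_timesI[OF der])
  qed simp
  moreover have "max d a < b" using cd ab by simp
  ultimately have "\<Phi> \<in> test_functions a b"
    unfolding test_functions_def all_differentiable_iff using cd \<Phi>0 by blast
  with d that show ?thesis by blast
qed

text \<open>A suitable multiple of one fixed bump \<open>\<theta>\<close> corrects any test function
  \<open>\<phi>\<close> to mean zero, hence to the derivative of a test function, against which
  \<open>F\<close> integrates to 0. So the integral of \<open>F * \<phi>\<close> is \<open>C\<close>
  times that of \<open>\<phi>\<close>, with \<open>C\<close> read off from \<open>\<theta>\<close>,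
  and the fundamental lemma applies to \<open>F - C\<close>.\<close>

lemma du_bois_reymond:
  assumes ab: "a < b" and F: "integrable (lebesgue_on {a..b}) F"
    and z: "\<And>\<phi>. \<phi> \<in> test_functions a b \<Longrightarrow> integral\<^sup>L (lebesgue_on {a..b}) (\<lambda>x. F x * deriv \<phi> x) = 0"
  obtains C where "AE x in lebesgue_on {a..b}. F x = C"
proof -
  let ?M = "lebesgue_on {a..b}"
  \<comment> \<open>Midpoint and a quarter of the length: the bump is supported strictly inside the
    interval and is positive at \<open>m\<close>.\<close>
  define m where "m = (a + b) / 2"
  define w where "w = (b - a) / 4"
  define \<theta> where "\<theta> = bump (m - w) (m + w) 1"
  have \<theta>: "\<theta> \<in> test_functions a b"
    unfolding \<theta>_def by (rule bump_test_function) (use ab in \<open>auto simp: m_def w_def field_simps\<close>)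
  have ti: "integrable ?M \<phi>" if "\<phi> \<in> test_functions a b" for \<phi>
    by (rule continuous_imp_integrable_real[OF test_function_continuous[OF that]])
  have Fi: "integrable ?M (\<lambda>x. F x * \<phi> x)" if "\<phi> \<in> test_functions a b" for \<phi>
    using integrable_continuous_mult[OF test_function_continuous[OF that] F] by (simp add: mult.commute)
  define I where "I = integral\<^sup>L ?M \<theta>"
  have "I \<noteq> 0"
  proof
    assume "I = 0"
    hence "\<forall>x\<in>{a..b}. \<theta> x = 0"
      unfolding I_def using integralL_eq_0_iff[OF test_function_continuous[OF \<theta>] ab]
      by (simp add: \<theta>_def bump_bounds)
    moreover have "\<theta> m > 0" "m \<in> {a..b}"
      using ab by (auto simp: \<theta>_def bump_def exp_inv_def w_def m_def field_simps)
    ultimately show False by auto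
  qed
  define C where "C = integral\<^sup>L ?M (\<lambda>x. F x * \<theta> x) / I"
  have "AE x in ?M. F x - C = 0"
  proof (rule fundamental_lemma)
    show "integrable ?M (\<lambda>x. F x - C)" using F by simp
    fix \<phi> assume \<phi>: "\<phi> \<in> test_functions a b"
    define k where "k = - integral\<^sup>L ?M \<phi> / I"
    have "(\<lambda>x. \<phi> x + k * \<theta> x) \<in> test_functions a b"
      by (rule test_functions_combination[OF \<phi> \<theta>])
    moreover have "integral\<^sup>L ?M (\<lambda>x. \<phi> x + k * \<theta> x) = 0"
      using ti[OF \<phi>] ti[OF \<theta>] \<open>I \<noteq> 0\<close> by (simp add: I_def[symmetric] k_def)
    ultimately obtain \<Phi> where \<Phi>: "\<Phi> \<in> test_functions a b" "deriv \<Phi> = (\<lambda>x. \<phi> x + k * \<theta> x)"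
      using test_function_primitive[OF ab] by blast
    have "integral\<^sup>L ?M (\<lambda>x. F x * \<phi> x) + k * integral\<^sup>L ?M (\<lambda>x. F x * \<theta> x) =
        integral\<^sup>L ?M (\<lambda>x. F x * (\<phi> x + k * \<theta> x))"
      using Fi[OF \<phi>] Fi[OF \<theta>] by (simp add: distrib_left mult.left_commute[of _ k])
    also have "\<dots> = 0" using z[OF \<Phi>(1)] \<Phi>(2) by simp
    finally show "integral\<^sup>L ?M (\<lambda>x. (F x - C) * \<phi> x) = 0"
      using Fi[OF \<phi>] ti[OF \<phi>] \<open>I \<noteq> 0\<close> by (simp add: left_diff_distrib C_def k_def field_simps)
  qed
  thus ?thesis by (intro that[of C]) simp
qed

section \<open>Absolutely continuous representatives of Sobolev functions\<close>

lemma L2_on_measurable: "f \<in> L2_on a b \<Longrightarrow> f \<in> borel_measurable (lebesgue_on {a..b})"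
  by (simp add: L2_on_def)

lemma L2_on_mult_integrable:
  assumes f: "f \<in> L2_on a b" and g: "g \<in> L2_on a b"
  shows "integrable (lebesgue_on {a..b}) (\<lambda>x. f x * g x)"
proof (rule Bochner_Integration.integrable_bound)
  show "integrable (lebesgue_on {a..b}) (\<lambda>x. (f x)\<^sup>2 + (g x)\<^sup>2)"
    using f g by (simp add: L2_on_def)
  show "(\<lambda>x. f x * g x) \<in> borel_measurable (lebesgue_on {a..b})"
    using f g by (intro borel_measurable_times L2_on_measurable)
  have "norm (f x * g x) \<le> norm ((f x)\<^sup>2 + (g x)\<^sup>2)" for x
  proof -
    have "2 * \<bar>f x * g x\<bar> \<le> (f x)\<^sup>2 + (g x)\<^sup>2"
      using sum_squares_bound[of "\<bar>f x\<bar>" "\<bar>g x\<bar>"] by (simp add: abs_mult)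
    thus ?thesis by simp
  qed
  thus "AE x in lebesgue_on {a..b}. norm (f x * g x) \<le> norm ((f x)\<^sup>2 + (g x)\<^sup>2)" by simp
qed

lemma continuous_L2_on: "continuous_on {a..b} f \<Longrightarrow> f \<in> L2_on a b"
  unfolding L2_on_def
  by (auto intro!: continuous_imp_integrable_real continuous_intros borel_measurable_integrable)

lemma L2_on_integrable: "f \<in> L2_on a b \<Longrightarrow> integrable (lebesgue_on {a..b}) f"
  using L2_on_mult_integrable[of f a b "\<lambda>x. 1"] continuous_L2_on[of a b "\<lambda>x. 1"] by simp

lemma L2_on_combination:
  assumes f: "f \<in> L2_on a b" and g: "g \<in> L2_on a b"
  shows "(\<lambda>x. c * f x + d * g x) \<in> L2_on a b"
proof -
  have "integrable (lebesgue_on {a..b}) (\<lambda>x. c\<^sup>2 * (f x)\<^sup>2 + d\<^sup>2 * (g x)\<^sup>2 + 2 * c * d * (f x * g x))"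
    using f g L2_on_mult_integrable[OF f g] by (simp add: L2_on_def)
  hence "integrable (lebesgue_on {a..b}) (\<lambda>x. (c * f x + d * g x)\<^sup>2)"
    by (simp add: power2_sum power_mult_distrib algebra_simps)
  moreover have "(\<lambda>x. c * f x + d * g x) \<in> borel_measurable (lebesgue_on {a..b})"
    using L2_on_measurable[OF f] L2_on_measurable[OF g] by measurable
  ultimately show ?thesis by (simp add: L2_on_def)
qed

text \<open>Measurability of \<open>g\<close> comes from completeness of Lebesgue measure, applied
  to the extensions by zero. This is what lets weak derivatives be moved between
  representatives.\<close>

lemma L2_on_cong_AE:
  assumes f: "f \<in> L2_on a b" and ae: "AE x in lebesgue_on {a..b}. f x = g x"
  shows "g \<in> L2_on a b"
proof -
  have "(\<lambda>x. if x \<in> {a..b} then f x else 0) \<in> borel_measurable lebesgue"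
    using L2_on_measurable[OF f] by (subst borel_measurable_if) auto
  moreover have "AE x in lebesgue. (if x \<in> {a..b} then f x else 0) = (if x \<in> {a..b} then g x else 0)"
    using ae by (auto simp: AE_restrict_space_iff elim: eventually_mono)
  ultimately have "(\<lambda>x. if x \<in> {a..b} then g x else 0) \<in> borel_measurable lebesgue"
    by (rule borel_measurable_AE)
  hence m: "g \<in> borel_measurable (lebesgue_on {a..b})"
    by (subst (asm) borel_measurable_if) auto
  have "integrable (lebesgue_on {a..b}) (\<lambda>x. (g x)\<^sup>2)"
  proof (rule integrable_cong_AE_imp)
    show "integrable (lebesgue_on {a..b}) (\<lambda>x. (f x)\<^sup>2)" using f by (simp add: L2_on_def)
    show "(\<lambda>x. (g x)\<^sup>2) \<in> borel_measurable (lebesgue_on {a..b})" using m by measurable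
    show "AE x in lebesgue_on {a..b}. (f x)\<^sup>2 = (g x)\<^sup>2" using ae by (rule eventually_mono) simp
  qed
  with m show ?thesis by (simp add: L2_on_def)
qed

text \<open>The squared difference is continuous and nonnegative with zero integral. Equality
  therefore reaches every point, including the ends, where the boundary conditions live.\<close>

lemma continuous_AE_eq:
  fixes f g :: "real \<Rightarrow> real"
  assumes "a < b" and f: "continuous_on {a..b} f" and g: "continuous_on {a..b} g"
    and ae: "AE x in lebesgue_on {a..b}. f x = g x" and x: "x \<in> {a..b}"
  shows "f x = g x"
proof -
  have "integral\<^sup>L (lebesgue_on {a..b}) (\<lambda>x. (f x - g x)\<^sup>2) = 0"
    by (rule integral_eq_zero_AE) (use ae in \<open>auto elim: eventually_mono\<close>)
  moreover have "continuous_on {a..b} (\<lambda>x. (f x - g x)\<^sup>2)"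
    using f g by (intro continuous_intros)
  ultimately have "\<forall>x\<in>{a..b}. (f x - g x)\<^sup>2 = 0"
    using integralL_eq_0_iff[of a b "\<lambda>x. (f x - g x)\<^sup>2"] \<open>a < b\<close> by simp
  with x show ?thesis by simp
qed

lemma ac_has_sobolev_deriv:
  assumes "ac_on a b f p" "p \<in> L2_on a b" "a \<le> b"
  shows "has_sobolev_deriv a b f p"
  unfolding has_sobolev_deriv_def integral_on_def
  using assms continuous_L2_on[OF ac_on_continuous[OF assms(1)]] ac_on_weak_derivative[OF assms(1,3)] by blast

lemma has_sobolev_deriv_cong_AE:
  assumes f: "has_sobolev_deriv a b f p" and ae: "AE x in lebesgue_on {a..b}. f x = g x"
  shows "has_sobolev_deriv a b g p"
proof -
  have fL: "f \<in> L2_on a b" using f by (simp add: has_sobolev_deriv_def)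
  have gL: "g \<in> L2_on a b" by (rule L2_on_cong_AE[OF fL ae])
  have "integral\<^sup>L (lebesgue_on {a..b}) (\<lambda>x. g x * deriv \<phi> x) = integral\<^sup>L (lebesgue_on {a..b}) (\<lambda>x. f x * deriv \<phi> x)"
    if "\<phi> \<in> test_functions a b" for \<phi>
  proof (rule integral_cong_AE)
    have "deriv \<phi> \<in> borel_measurable (lebesgue_on {a..b})"
      using ac_on_integrable[OF test_function_ac(1)[OF that]] by auto
    thus "(\<lambda>x. g x * deriv \<phi> x) \<in> borel_measurable (lebesgue_on {a..b})"
      "(\<lambda>x. f x * deriv \<phi> x) \<in> borel_measurable (lebesgue_on {a..b})"
      using L2_on_measurable[OF fL] L2_on_measurable[OF gL] by measurable
    show "AE x in lebesgue_on {a..b}. g x * deriv \<phi> x = f x * deriv \<phi> x"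
      using ae by (rule eventually_mono) simp
  qed
  with f gL show ?thesis by (simp add: has_sobolev_deriv_def integral_on_def)
qed

lemma has_sobolev_deriv_unique:
  assumes g: "has_sobolev_deriv a b f g" and h: "has_sobolev_deriv a b f h"
  shows "AE x in lebesgue_on {a..b}. g x = h x"
proof -
  have gi: "integrable (lebesgue_on {a..b}) g" and hi: "integrable (lebesgue_on {a..b}) h"
    using g h by (auto simp: has_sobolev_deriv_def intro: L2_on_integrable)
  have "AE x in lebesgue_on {a..b}. g x - h x = 0"
  proof (rule fundamental_lemma)
    show "integrable (lebesgue_on {a..b}) (\<lambda>x. g x - h x)" using gi hi by simp
    fix \<phi> assume \<phi>: "\<phi> \<in> test_functions a b"
    have "integrable (lebesgue_on {a..b}) (\<lambda>x. g x * \<phi> x)" "integrable (lebesgue_on {a..b}) (\<lambda>x. h x * \<phi> x)"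
      using integrable_continuous_mult[OF test_function_continuous[OF \<phi>] gi]
        integrable_continuous_mult[OF test_function_continuous[OF \<phi>] hi] by (simp_all add: mult.commute)
    moreover have "integral\<^sup>L (lebesgue_on {a..b}) (\<lambda>x. g x * \<phi> x) = integral\<^sup>L (lebesgue_on {a..b}) (\<lambda>x. h x * \<phi> x)"
      using g h \<phi> by (simp add: has_sobolev_deriv_def integral_on_def)
    ultimately show "integral\<^sup>L (lebesgue_on {a..b}) (\<lambda>x. (g x - h x) * \<phi> x) = 0"
      by (simp add: left_diff_distrib)
  qed
  thus ?thesis by simp
qed

text \<open>The primitive \<open>G\<close> of \<open>g\<close> has the same weak derivative as
  \<open>f\<close>, so \<open>f - G\<close> is almost everywhere constant by du Bois-Reymond; the
  representative is \<open>G\<close> plus that constant.\<close>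

lemma has_sobolev_deriv_imp_ac:
  assumes ab: "a < b" and f: "has_sobolev_deriv a b f g"
  obtains h where "ac_on a b h g" "AE x in lebesgue_on {a..b}. f x = h x"
proof -
  let ?M = "lebesgue_on {a..b}"
  have fi: "integrable ?M f" and gi: "integrable ?M g"
    using f by (auto simp: has_sobolev_deriv_def intro: L2_on_integrable)
  define G where "G = (\<lambda>x. 0 + integral\<^sup>L (lebesgue_on {a..x}) g)"
  have G: "ac_on a b G g" unfolding G_def by (rule ac_on_primitive[OF gi])
  have Gi: "integrable ?M G" by (rule continuous_imp_integrable_real[OF ac_on_continuous[OF G]])
  obtain C where C: "AE x in ?M. f x - G x = C"
  proof (rule du_bois_reymond[OF ab, of "\<lambda>x. f x - G x"])
    show "integrable ?M (\<lambda>x. f x - G x)" using fi Gi by simp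
    fix \<phi> assume \<phi>: "\<phi> \<in> test_functions a b"
    have "deriv \<phi> differentiable at x" for x
      using \<phi> unfolding test_functions_def by (auto dest: spec[of _ "Suc 0"])
    hence c: "continuous_on {a..b} (deriv \<phi>)"
      by (meson continuous_at_imp_continuous_on differentiable_imp_continuous_within)
    have "integrable ?M (\<lambda>x. f x * deriv \<phi> x)" "integrable ?M (\<lambda>x. G x * deriv \<phi> x)"
      using integrable_continuous_mult[OF c fi] integrable_continuous_mult[OF c Gi] by (simp_all add: mult.commute)
    moreover have "integral\<^sup>L ?M (\<lambda>x. f x * deriv \<phi> x) = integral\<^sup>L ?M (\<lambda>x. G x * deriv \<phi> x)"
      using f \<phi> ac_on_weak_derivative[OF G _ \<phi>] ab by (simp add: has_sobolev_deriv_def integral_on_def)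
    ultimately show "integral\<^sup>L ?M (\<lambda>x. (f x - G x) * deriv \<phi> x) = 0"
      by (simp add: left_diff_distrib)
  qed
  have "AE x in ?M. f x = C + G x"
    using C by (rule eventually_mono) simp
  moreover have "ac_on a b (\<lambda>x. C + G x) g"
    using ac_on_add[OF ac_on_const G] by simp
  ultimately show ?thesis using that by blast
qed

text \<open>
  Here \<open>f1\<close> is the continuous representative of the first Sobolev derivative and \<open>f2\<close> any
  representative of the second, so that no choice made by \<^const>\<open>sobolev_deriv\<close> enters.
\<close>

definition W22_rep :: "real \<Rightarrow> real \<Rightarrow> (real \<Rightarrow> real) \<Rightarrow> (real \<Rightarrow> real) \<Rightarrow> (real \<Rightarrow> real) \<Rightarrow> bool" where
  "W22_rep a b f f1 f2 \<longleftrightarrow> (\<forall>x. x \<notin> {a..b} \<longrightarrow> f x = 0) \<and> f a = 0 \<and> f b = 0 \<and>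
     ac_on a b f f1 \<and> ac_on a b f1 f2 \<and> f2 \<in> L2_on a b"

text \<open>Since \<open>f\<close> is continuous, it coincides everywhere with its absolutely
  continuous representative, so the boundary values survive. Its density \<open>p\<close> may then
  be replaced by the representative \<open>f1\<close> of \<open>p\<close>, because densities matter
  only almost everywhere.\<close>

lemma W22_obtain_rep:
  assumes ab: "a < b" and f: "f \<in> W22 a b"
  obtains f1 f2 where "W22_rep a b f f1 f2"
proof -
  from f obtain p q where p: "has_sobolev_deriv a b f p" and q: "has_sobolev_deriv a b p q"
    and c: "continuous_on {a..b} f" and z: "\<forall>x. x \<notin> {a..b} \<longrightarrow> f x = 0" "f a = 0" "f b = 0"
    unfolding W22_def by blast
  obtain h where h: "ac_on a b h p" "AE x in lebesgue_on {a..b}. f x = h x"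
    using has_sobolev_deriv_imp_ac[OF ab p] .
  obtain f1 where f1: "ac_on a b f1 q" "AE x in lebesgue_on {a..b}. p x = f1 x"
    using has_sobolev_deriv_imp_ac[OF ab q] .
  have "h x = f x" if "x \<in> {a..b}" for x
    using continuous_AE_eq[OF ab c ac_on_continuous[OF h(1)] h(2) that] by simp
  hence "ac_on a b f p" using ac_on_cong[OF h(1), of f p] ab by simp
  hence "ac_on a b f f1"
    by (rule ac_on_cong_AE[OF _ f1(2)])
       (rule L2_on_measurable[OF continuous_L2_on[OF ac_on_continuous[OF f1(1)]]])
  moreover have "q \<in> L2_on a b" using q by (simp add: has_sobolev_deriv_def)
  ultimately show ?thesis using that f1(1) z by (simp add: W22_rep_def)
qed

lemma W22_rep_sobolev:
  assumes ab: "a \<le> b" and r: "W22_rep a b f f1 f2"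
  shows "f \<in> W22 a b"
    and "sobolev_deriv a b f \<in> L2_on a b" "AE x in lebesgue_on {a..b}. sobolev_deriv a b f x = f1 x"
    and "sobolev_deriv2 a b f \<in> L2_on a b" "AE x in lebesgue_on {a..b}. sobolev_deriv2 a b f x = f2 x"
proof -
  have d1: "has_sobolev_deriv a b f f1"
    using r ab by (intro ac_has_sobolev_deriv) (auto simp: W22_rep_def intro: continuous_L2_on[OF ac_on_continuous])
  have d2: "has_sobolev_deriv a b f1 f2"
    using r ab by (intro ac_has_sobolev_deriv) (auto simp: W22_rep_def)
  show "f \<in> W22 a b"
    using r d1 d2 unfolding W22_def W22_rep_def by (blast intro: ac_on_continuous)
  have s1: "has_sobolev_deriv a b f (sobolev_deriv a b f)"
    unfolding sobolev_deriv_def by (rule someI[of _ f1]) (rule d1)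
  show ae: "AE x in lebesgue_on {a..b}. sobolev_deriv a b f x = f1 x"
    by (rule has_sobolev_deriv_unique[OF s1 d1])
  \<comment> \<open>\<open>sobolev_deriv2\<close> differentiates the chosen first derivative, which
    agrees with \<open>f1\<close> only almost everywhere; the second derivative must be carried
    across that null set.\<close>
  have d2': "has_sobolev_deriv a b (sobolev_deriv a b f) f2"
    by (rule has_sobolev_deriv_cong_AE[OF d2]) (use ae in \<open>auto elim: eventually_mono\<close>)
  have s2: "has_sobolev_deriv a b (sobolev_deriv a b f) (sobolev_deriv2 a b f)"
    unfolding sobolev_deriv_def[of a b "sobolev_deriv a b f"] by (rule someI[of _ f2]) (rule d2')
  show "AE x in lebesgue_on {a..b}. sobolev_deriv2 a b f x = f2 x"
    by (rule has_sobolev_deriv_unique[OF s2 d2'])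
  show "sobolev_deriv a b f \<in> L2_on a b" "sobolev_deriv2 a b f \<in> L2_on a b"
    using s2 by (auto simp: has_sobolev_deriv_def)
qed

section \<open>The inner product and the forms in terms of representatives\<close>

lemma W22_rep_combination:
  assumes f: "W22_rep a b f f1 f2" and g: "W22_rep a b g g1 g2"
  shows "W22_rep a b (\<lambda>x. c * f x + d * g x) (\<lambda>x. c * f1 x + d * g1 x) (\<lambda>x. c * f2 x + d * g2 x)"
  using assms unfolding W22_rep_def
  by (auto intro!: ac_on_add ac_on_cmult L2_on_combination)

lemma W22_rep_L2:
  assumes "W22_rep a b f f1 f2"
  shows "f \<in> L2_on a b" "f1 \<in> L2_on a b" "f2 \<in> L2_on a b"
  using assms unfolding W22_rep_def by (auto intro: continuous_L2_on[OF ac_on_continuous])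

text \<open>The weight \<open>k\<close> makes one statement serve both the plain products
  (\<open>k = 1\<close>) and the products weighted by the path.\<close>

lemma integral_on_mult_cong_AE:
  assumes "u \<in> L2_on a b" "v \<in> L2_on a b" "u' \<in> L2_on a b" "v' \<in> L2_on a b"
    and "AE x in lebesgue_on {a..b}. u x = u' x" "AE x in lebesgue_on {a..b}. v x = v' x"
    and k: "k \<in> borel_measurable (lebesgue_on {a..b})"
  shows "integral_on a b (\<lambda>x. u x * v x * k x) = integral_on a b (\<lambda>x. u' x * v' x * k x)"
  unfolding integral_on_def
proof (rule integral_cong_AE)
  show "(\<lambda>x. u x * v x * k x) \<in> borel_measurable (lebesgue_on {a..b})"
    "(\<lambda>x. u' x * v' x * k x) \<in> borel_measurable (lebesgue_on {a..b})"
    using assms(1-4)[THEN L2_on_measurable] k by measurable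
  show "AE x in lebesgue_on {a..b}. u x * v x * k x = u' x * v' x * k x"
    using assms(5,6) by eventually_elim simp
qed

lemma inner22_rep:
  assumes ab: "a \<le> b" and f: "W22_rep a b f f1 f2" and g: "W22_rep a b g g1 g2"
  shows "inner22 a b f g = integral_on a b (\<lambda>x. f x * g x) +
     integral_on a b (\<lambda>x. f1 x * g1 x) + integral_on a b (\<lambda>x. f2 x * g2 x)"
proof -
  note F = W22_rep_sobolev[OF ab f] W22_rep_L2[OF f] and G = W22_rep_sobolev[OF ab g] W22_rep_L2[OF g]
  have one: "(\<lambda>x. 1) \<in> borel_measurable (lebesgue_on {a..b})" by simp
  show ?thesis
    unfolding inner22_def
    using integral_on_mult_cong_AE[OF F(2) G(2) F(7) G(7) F(3) G(3) one]
      integral_on_mult_cong_AE[OF F(4) G(4) F(8) G(8) F(5) G(5) one] by simp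
qed

lemma L2_on_mult_continuous_integrable:
  assumes "u \<in> L2_on a b" "v \<in> L2_on a b" "continuous_on {a..b} w"
  shows "integrable (lebesgue_on {a..b}) (\<lambda>x. u x * v x * w x)"
  using integrable_continuous_mult[OF assms(3) L2_on_mult_integrable[OF assms(1,2)]]
  by (simp add: mult.commute)

lemma form_eps1_rep:
  assumes ab: "a \<le> b" and w: "continuous_on {a..b} w" and f: "W22_rep a b f f1 f2" and g: "W22_rep a b g g1 g2"
  shows "form_eps1 a b w f g =
     - integral_on a b (\<lambda>x. f1 x * g1 x) / 4 + integral_on a b (\<lambda>x. f2 x * g x * w x) / 4 +
     integral_on a b (\<lambda>x. f x * g2 x * w x) / 4 + integral_on a b (\<lambda>x. f1 x * g1 x * w x) / 2"
proof -
  note F = W22_rep_sobolev[OF ab f] W22_rep_L2[OF f] and G = W22_rep_sobolev[OF ab g] W22_rep_L2[OF g]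
  have one: "(\<lambda>x. 1) \<in> borel_measurable (lebesgue_on {a..b})" by simp
  note wm = L2_on_measurable[OF continuous_L2_on[OF w]]
  have ae: "AE x in M. h x = h x" for M and h :: "real \<Rightarrow> real" by simp
  show ?thesis
    unfolding form_eps1_def
    using integral_on_mult_cong_AE[OF F(2) G(2) F(7) G(7) F(3) G(3) one]
      integral_on_mult_cong_AE[OF F(2) G(2) F(7) G(7) F(3) G(3) wm]
      integral_on_mult_cong_AE[OF F(4) G(6) F(8) G(6) F(5) ae wm]
      integral_on_mult_cong_AE[OF F(6) G(4) F(6) G(8) ae G(5) wm]
    by (simp add: integral_on_def)
qed

lemma form_eps2_rep:
  assumes ab: "a \<le> b" and w: "continuous_on {a..b} w" and f: "W22_rep a b f f1 f2" and g: "W22_rep a b g g1 g2"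
  shows "form_eps2 a b w f g =
     - integral_on a b (\<lambda>x. f1 x * g1 x) / 4 + integral_on a b (\<lambda>x. f2 x * g x * w x) / 4 -
     integral_on a b (\<lambda>x. f x * g2 x * w x) / 4"
proof -
  note F = W22_rep_sobolev[OF ab f] W22_rep_L2[OF f] and G = W22_rep_sobolev[OF ab g] W22_rep_L2[OF g]
  have one: "(\<lambda>x. 1) \<in> borel_measurable (lebesgue_on {a..b})" by simp
  note wm = L2_on_measurable[OF continuous_L2_on[OF w]]
  have ae: "AE x in M. h x = h x" for M and h :: "real \<Rightarrow> real" by simp
  show ?thesis
    unfolding form_eps2_def
    using integral_on_mult_cong_AE[OF F(2) G(2) F(7) G(7) F(3) G(3) one]
      integral_on_mult_cong_AE[OF F(4) G(6) F(8) G(6) F(5) ae wm]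
      integral_on_mult_cong_AE[OF F(6) G(4) F(6) G(8) ae G(5) wm]
    by (simp add: integral_on_def)
qed

text \<open>The two terms with \<open>f\<close> and the second derivative of \<open>g\<close> cancel
  and the quarters add up to halves. The analytic content is the integrability that permits
  splitting the integral in \<open>form_eps\<close>.\<close>

lemma form_eps_decomposition:
  assumes ab: "a < b" and w: "continuous_on {a..b} w" and f: "f \<in> W22 a b" and g: "g \<in> W22 a b"
  shows "form_eps a b w f g = form_eps1 a b w f g + form_eps2 a b w f g"
proof -
  obtain f1 f2 g1 g2 where f: "W22_rep a b f f1 f2" and g: "W22_rep a b g g1 g2"
    using W22_obtain_rep[OF ab] f g by metis
  have ab': "a \<le> b" using ab by simp
  note F = W22_rep_sobolev[OF ab' f] W22_rep_L2[OF f] and G = W22_rep_sobolev[OF ab' g] W22_rep_L2[OF g]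
  have "integrable (lebesgue_on {a..b}) (\<lambda>t. sobolev_deriv2 a b f t * g t * w t)"
    "integrable (lebesgue_on {a..b}) (\<lambda>t. sobolev_deriv a b f t * sobolev_deriv a b g t * w t)"
    using L2_on_mult_continuous_integrable[OF F(4) G(6) w] L2_on_mult_continuous_integrable[OF F(2) G(2) w] .
  hence "integral_on a b (\<lambda>t. 1/2 * (sobolev_deriv2 a b f t * g t + sobolev_deriv a b f t * sobolev_deriv a b g t) * w t) =
     integral_on a b (\<lambda>t. sobolev_deriv2 a b f t * g t * w t) / 2 +
     integral_on a b (\<lambda>t. sobolev_deriv a b f t * sobolev_deriv a b g t * w t) / 2"
    unfolding integral_on_def by (simp add: distrib_left distrib_right add_divide_distrib)
  thus ?thesis
    unfolding form_eps_def form_eps1_def form_eps2_def by (simp add: integral_on_def)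
qed

section \<open>Riesz representation by an explicit boundary value problem\<close>

lemma ac_on_linear: "ac_on a b (\<lambda>x. c * (x - a)) (\<lambda>x. c :: real)"
  by (rule ac_on_of_vector_derivative)
     (auto intro!: derivative_eq_intros simp flip: has_real_derivative_iff_has_vector_derivative)

text \<open>
  Subtracting the mean of \<open>q\<close> makes the primitive vanish at both ends, so that integrating by parts
  against \<open>g''\<close> leaves no boundary term although \<open>g'\<close> is free there.
\<close>

definition centred_primitive :: "real \<Rightarrow> real \<Rightarrow> (real \<Rightarrow> real) \<Rightarrow> real \<Rightarrow> real" where
  "centred_primitive a b q x = integral\<^sup>L (lebesgue_on {a..x}) q
     - integral\<^sup>L (lebesgue_on {a..b}) q / (b - a) * (x - a)"

lemma centred_primitive_ac:
  assumes "integrable (lebesgue_on {a..b}) q"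
  shows "ac_on a b (centred_primitive a b q) (\<lambda>x. q x + - (integral\<^sup>L (lebesgue_on {a..b}) q / (b - a)))"
proof -
  have "ac_on a b (\<lambda>x. (0 + integral\<^sup>L (lebesgue_on {a..x}) q) +
      - (integral\<^sup>L (lebesgue_on {a..b}) q / (b - a)) * (x - a))
     (\<lambda>x. q x + - (integral\<^sup>L (lebesgue_on {a..b}) q / (b - a)))"
    by (intro ac_on_add ac_on_primitive[OF assms] ac_on_linear)
  thus ?thesis unfolding centred_primitive_def[abs_def] by simp
qed

lemma centred_primitive_ends:
  assumes "a < b"
  shows "centred_primitive a b q a = 0" "centred_primitive a b q b = 0"
  using assms by (simp_all add: centred_primitive_def)

text \<open>Replacing \<open>q\<close> by \<open>q - m\<close> costs nothing on the left, since the
  integral of \<open>g1\<close> is \<open>g b - g a = 0\<close>.\<close>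

lemma integral_deriv_as_second_deriv:
  assumes ab: "a < b" and q: "integrable (lebesgue_on {a..b}) q" and g: "W22_rep a b g g1 g2"
  shows "integral_on a b (\<lambda>x. q x * g1 x) = - integral_on a b (\<lambda>x. centred_primitive a b q x * g2 x)"
proof -
  let ?M = "lebesgue_on {a..b}"
  define m where "m = integral\<^sup>L ?M q / (b - a)"
  have g1: "ac_on a b g g1" and g2: "ac_on a b g1 g2" and z: "g a = 0" "g b = 0"
    using g by (auto simp: W22_rep_def)
  have "integral\<^sup>L ?M g1 = 0" using ac_on_eq[OF g1, of b] ab z by simp
  moreover have "integrable ?M (\<lambda>x. q x * g1 x)"
    using integrable_continuous_mult[OF ac_on_continuous[OF g2] q] by (simp add: mult.commute)
  moreover have "integral\<^sup>L ?M (\<lambda>x. centred_primitive a b q x * g2 x) = - integral\<^sup>L ?M (\<lambda>x. (q x + - m) * g1 x)"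
    using integral_by_parts_ac[OF centred_primitive_ac[OF q] g2] ab centred_primitive_ends[OF ab, of q] by (simp add: m_def)
  ultimately show ?thesis
    using ac_on_integrable[OF g1] by (simp add: integral_on_def left_diff_distrib)
qed

text \<open>Two integrations by parts for \<open>p\<close>, one for \<open>q\<close>, none for
  \<open>r\<close>; each contributes a sign. The first one for \<open>p\<close> may use the plain
  primitive because \<open>g\<close> vanishes at the ends, whereas those that meet \<open>g1\<close>
  at the boundary need the centred one.\<close>

lemma functional_as_second_deriv:
  assumes ab: "a < b" and p: "integrable (lebesgue_on {a..b}) p"
    and q: "integrable (lebesgue_on {a..b}) q" and r: "continuous_on {a..b} r"
  obtains R where "continuous_on {a..b} R"
    "\<And>g g1 g2. W22_rep a b g g1 g2 \<Longrightarrow>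
      integral_on a b (\<lambda>x. p x * g x) + integral_on a b (\<lambda>x. q x * g1 x) + integral_on a b (\<lambda>x. r x * g2 x)
      = integral_on a b (\<lambda>x. R x * g2 x)"
proof -
  define P where "P = (\<lambda>x. 0 + integral\<^sup>L (lebesgue_on {a..x}) p)"
  have P: "ac_on a b P p" unfolding P_def by (rule ac_on_primitive[OF p])
  have Pi: "integrable (lebesgue_on {a..b}) P" by (rule continuous_imp_integrable_real[OF ac_on_continuous[OF P]])
  let ?Z = "centred_primitive a b"
  have ZP: "continuous_on {a..b} (?Z P)" and Zq: "continuous_on {a..b} (?Z q)"
    using centred_primitive_ac[OF Pi] centred_primitive_ac[OF q] by (auto intro: ac_on_continuous)
  define R where "R = (\<lambda>x. ?Z P x + - ?Z q x + r x)"
  show ?thesis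
  proof (rule that)
    show "continuous_on {a..b} R" unfolding R_def using ZP Zq r by (intro continuous_intros)
    fix g g1 g2 assume g: "W22_rep a b g g1 g2"
    have g1: "ac_on a b g g1" and g2: "integrable (lebesgue_on {a..b}) g2" and z: "g a = 0" "g b = 0"
      using g by (auto simp: W22_rep_def intro: L2_on_integrable)
    have "integral_on a b (\<lambda>x. p x * g x) = - integral_on a b (\<lambda>x. P x * g1 x)"
      using integral_by_parts_ac[OF P g1] ab z by (simp add: integral_on_def)
    also have "\<dots> = integral_on a b (\<lambda>x. ?Z P x * g2 x)"
      using integral_deriv_as_second_deriv[OF ab Pi g] by simp
    finally have "integral_on a b (\<lambda>x. p x * g x) = integral_on a b (\<lambda>x. ?Z P x * g2 x)" .
    moreover have "integral_on a b (\<lambda>x. q x * g1 x) = - integral_on a b (\<lambda>x. ?Z q x * g2 x)"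
      by (rule integral_deriv_as_second_deriv[OF ab q g])
    moreover have "integral_on a b (\<lambda>x. R x * g2 x) = integral_on a b (\<lambda>x. ?Z P x * g2 x)
        - integral_on a b (\<lambda>x. ?Z q x * g2 x) + integral_on a b (\<lambda>x. r x * g2 x)"
      using integrable_continuous_mult[OF ZP g2] integrable_continuous_mult[OF Zq g2] integrable_continuous_mult[OF r g2]
      by (simp add: R_def integral_on_def distrib_right left_diff_distrib)
    ultimately show "integral_on a b (\<lambda>x. p x * g x) + integral_on a b (\<lambda>x. q x * g1 x) + integral_on a b (\<lambda>x. r x * g2 x)
      = integral_on a b (\<lambda>x. R x * g2 x)" by simp
  qed
qed

section \<open>Boundary value problems of second and fourth order\<close>

lemma dirichlet_problem:
  fixes k :: complex and R :: "real \<Rightarrow> complex"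
  assumes ab: "a < b" and k: "Re k > 0" and R: "continuous_on {a..b} R"
  obtains y y1 where "ac_on a b y y1" "ac_on a b y1 (\<lambda>x. k^2 * y x + R x)" "y a = 0" "y b = 0"
proof -
  define E where "E = (\<lambda>c (x::real). exp (c * of_real (x - a)) :: complex)"
  have E: "ac_on a b (E c) (\<lambda>x. c * E c x)" for c
  proof (rule ac_on_of_vector_derivative)
    have "((\<lambda>z. exp (c * (z - of_real a))) has_field_derivative c * exp (c * (of_real x - of_real a))) (at (of_real x))" for x
      by (auto intro!: derivative_eq_intros)
    thus "(E c has_vector_derivative c * E c x) (at x within {a..b})" for x
      unfolding E_def of_real_diff by (rule has_vector_derivative_real_field)
    show "continuous_on {a..b} (\<lambda>x. c * E c x)"
      unfolding E_def by (intro continuous_intros)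
  qed
  have ER: "continuous_on {a..b} (\<lambda>x. E (- c) x * R x)" for c
    using ac_on_continuous[OF E] R by (intro continuous_on_mult) auto
  \<comment> \<open>Variation of constants: \<open>V c\<close> below solves \<open>V' = c V + R\<close>, \<open>V a = 0\<close>, and \<open>y'' - k\<^sup>2 y\<close> factors
    as \<open>(D - k) (D + k) y\<close>.\<close>
  define U where "U = (\<lambda>c x. 0 + integral\<^sup>L (lebesgue_on {a..x}) (\<lambda>x. E (- c) x * R x))"
  have U: "ac_on a b (U c) (\<lambda>x. E (- c) x * R x)" for c
    unfolding U_def by (rule ac_on_primitive[OF continuous_imp_integrable_real[OF ER]])
  have inv: "E c x * E (- c) x = 1" for c x
    by (simp add: E_def flip: exp_add)
  define V where "V = (\<lambda>c x. E c x * U c x)"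
  have V: "ac_on a b (V c) (\<lambda>x. R x + c * V c x)" for c
  proof -
    have "E c x * (E (- c) x * R x) + c * E c x * U c x = R x + c * V c x" for x
      using inv[of c x] by (simp add: V_def flip: mult.assoc)
    with ac_on_mult[OF E[of c] U[of c]] show ?thesis by (simp add: V_def)
  qed
  have Va: "V c a = 0" for c by (simp add: V_def U_def)
  have k0: "k \<noteq> 0" using k by auto
  \<comment> \<open>With \<open>V' = c V + R\<close> for \<open>c = k\<close> and
    \<open>c = - k\<close>, the \<open>R\<close> terms cancel in the derivative of
    \<open>(V k - V (- k)) / (2 k)\<close> and add up to exactly \<open>R\<close> in its second
    derivative.\<close>
  define y0 where "y0 = (\<lambda>x. (1 / (2 * k)) * V k x + (- 1 / (2 * k)) * V (- k) x)"
  define y01 where "y01 = (\<lambda>x. (1 / 2) * V k x + (1 / 2) * V (- k) x)"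
  have y0: "ac_on a b y0 y01"
  proof -
    have "ac_on a b y0 (\<lambda>x. (1 / (2 * k)) * (R x + k * V k x) + (- 1 / (2 * k)) * (R x + - k * V (- k) x))"
      unfolding y0_def by (intro ac_on_add ac_on_cmult V)
    also have "(\<lambda>x. (1 / (2 * k)) * (R x + k * V k x) + (- 1 / (2 * k)) * (R x + - k * V (- k) x)) = y01"
      using k0 by (simp add: y01_def fun_eq_iff field_simps)
    finally show ?thesis .
  qed
  have y01: "ac_on a b y01 (\<lambda>x. k^2 * y0 x + R x)"
  proof -
    have "ac_on a b y01 (\<lambda>x. (1 / 2) * (R x + k * V k x) + (1 / 2) * (R x + - k * V (- k) x))"
      unfolding y01_def by (intro ac_on_add ac_on_cmult V)
    also have "(\<lambda>x. (1 / 2) * (R x + k * V k x) + (1 / 2) * (R x + - k * V (- k) x)) = (\<lambda>x. k^2 * y0 x + R x)"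
      using k0 by (simp add: y0_def fun_eq_iff field_simps power2_eq_square)
    finally show ?thesis .
  qed
  \<comment> \<open>\<open>S\<close> is \<open>2 sinh (k (x - a))\<close>, the homogeneous solution
    vanishing at \<open>a\<close>. A multiple of it repairs the value at \<open>b\<close> without
    disturbing the one at \<open>a\<close>.\<close>
  define S where "S = (\<lambda>x. E k x + (- 1) * E (- k) x)"
  define S1 where "S1 = (\<lambda>x. k * E k x + k * E (- k) x)"
  have S: "ac_on a b S S1"
  proof -
    have "ac_on a b S (\<lambda>x. k * E k x + (- 1) * (- k * E (- k) x))"
      unfolding S_def by (intro ac_on_add ac_on_cmult E)
    thus ?thesis by (simp add: S1_def)
  qed
  have S1: "ac_on a b S1 (\<lambda>x. k^2 * S x)"
  proof -
    have "ac_on a b S1 (\<lambda>x. k * (k * E k x) + k * (- k * E (- k) x))"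
      unfolding S1_def by (intro ac_on_add ac_on_cmult E)
    thus ?thesis by (simp add: S_def algebra_simps power2_eq_square)
  qed
  have Sa: "S a = 0" by (simp add: S_def E_def)
  \<comment> \<open>Comparing moduli of the two exponentials leaves only \<open>Re k\<close>, which
    is positive.\<close>
  have Sb: "S b \<noteq> 0"
  proof
    assume "S b = 0"
    hence "E k b = E (- k) b" by (simp add: S_def)
    hence "norm (E k b) = norm (E (- k) b)" by simp
    hence "Re k * (b - a) = - Re k * (b - a)" by (simp add: E_def)
    with k ab show False by simp
  qed
  define c where "c = - y0 b / S b"
  have "ac_on a b (\<lambda>x. y0 x + c * S x) (\<lambda>x. y01 x + c * S1 x)"
    by (intro ac_on_add ac_on_cmult y0 S)
  moreover have "ac_on a b (\<lambda>x. y01 x + c * S1 x) (\<lambda>x. k^2 * (y0 x + c * S x) + R x)"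
  proof -
    have "ac_on a b (\<lambda>x. y01 x + c * S1 x) (\<lambda>x. (k^2 * y0 x + R x) + c * (k^2 * S x))"
      by (intro ac_on_add ac_on_cmult y01 S1)
    thus ?thesis by (simp add: algebra_simps)
  qed
  moreover have "y0 a + c * S a = 0" by (simp add: y0_def Va Sa)
  moreover have "y0 b + c * S b = 0" using Sb by (simp add: c_def)
  ultimately show ?thesis by (rule that)
qed

lemma fourth_order_problem:
  fixes R :: "real \<Rightarrow> real"
  assumes ab: "a < b" and R: "continuous_on {a..b} R"
  obtains z z1 h h1 where "ac_on a b z z1" "ac_on a b z1 h" "ac_on a b h h1"
    "ac_on a b h1 (\<lambda>x. R x + h x - z x)" "z a = 0" "z b = 0" "h a = 0" "h b = 0"
proof -
  \<comment> \<open>The operator \<open>D\<^sup>4 - D\<^sup>2 + 1\<close> is \<open>(D\<^sup>2 - k\<^sup>2) (D\<^sup>2 - cnj k\<^sup>2)\<close>. If \<open>y'' = k\<^sup>2 y + R\<close>, partial fractions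
    give \<open>z = Im y / Im k\<^sup>2\<close> and \<open>h = z'' = Im (k\<^sup>2 y) / Im k\<^sup>2\<close>.\<close>
  define k where "k = Complex (sqrt 3 / 2) (1 / 2)"
  have k2: "k^2 = Complex (1 / 2) (sqrt 3 / 2)"
    by (simp add: k_def power2_eq_square complex_eq_iff field_simps)
  \<comment> \<open>\<open>k\<close> is \<open>exp (i pi / 6)\<close>, so \<open>k^2\<close> is the
    primitive sixth root of unity \<open>exp (i pi / 3)\<close>, a root of
    \<open>X^2 - X + 1\<close>. Of its two square roots, \<open>k\<close> is the one with positive
    real part.\<close>
  have k4: "k^2 * k^2 = k^2 - 1"
    unfolding k2 by (simp add: complex_eq_iff field_simps)
  define s where "s = sqrt 3 / 2"
  have s0: "s \<noteq> 0" by (simp add: s_def)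
  have Im_k2: "Im (k^2) = s" by (simp add: k2 s_def)
  obtain y y1 where y: "ac_on a b y y1" "ac_on a b y1 (\<lambda>x. k^2 * y x + of_real (R x))" "y a = 0" "y b = 0"
    by (rule dirichlet_problem[OF ab, of k "\<lambda>x. of_real (R x)"])
       (use R in \<open>auto simp: k_def intro!: continuous_intros\<close>)
  define T where "T = (\<lambda>c v. Im (c * v) / s)"
  have T: "ac_on a b f p \<Longrightarrow> ac_on a b (\<lambda>x. T c (f x)) (\<lambda>x. T c (p x))" for f p c
    unfolding T_def
    by (rule ac_on_linear_image[where T = "\<lambda>v. Im (c * v) / s"], assumption,
        rule bounded_linear_compose[OF bounded_linear_divide bounded_linear_compose[OF bounded_linear_Im bounded_linear_mult_right]])
  \<comment> \<open>\<open>R\<close> is real, so it drops out when the imaginary part of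
    \<open>k^2 y + R\<close> is taken. After multiplication by \<open>k^2\<close> it returns with
    coefficient 1, because \<open>Im (k^2) = s\<close>.\<close>
  have e1: "T 1 (k^2 * v + of_real r) = T (k^2) v" for v r
    by (simp add: T_def)
  have e2: "T (k^2) (k^2 * v + of_real r) = r + T (k^2) v - T 1 v" for v r
  proof -
    have "k^2 * (k^2 * v + of_real r) = k^2 * v - v + k^2 * of_real r"
      using k4 by (simp add: distrib_left flip: mult.assoc) (simp add: left_diff_distrib)
    hence *: "Im (k^2 * (k^2 * v + of_real r)) = Im (k^2 * v) - Im v + s * r"
      using Im_k2 by simp
    show ?thesis using s0 unfolding T_def * by (simp add: add_divide_distrib diff_divide_distrib)
  qed
  show ?thesis
  proof (rule that)
    show "ac_on a b (\<lambda>x. T 1 (y x)) (\<lambda>x. T 1 (y1 x))" by (rule T[OF y(1)])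
    show "ac_on a b (\<lambda>x. T 1 (y1 x)) (\<lambda>x. T (k^2) (y x))" using T[OF y(2), of 1] by (simp only: e1)
    show "ac_on a b (\<lambda>x. T (k^2) (y x)) (\<lambda>x. T (k^2) (y1 x))" by (rule T[OF y(1)])
    show "ac_on a b (\<lambda>x. T (k^2) (y1 x)) (\<lambda>x. R x + T (k^2) (y x) - T 1 (y x))"
      using T[OF y(2), of "k^2"] by (simp only: e2)
  qed (simp_all add: y T_def)
qed

text \<open>
  Integrating by parts with \<open>z'' = h\<close> turns \<open>\<langle>h, g\<rangle>\<^sub>2\<close> into the integral of \<open>(z - h + h'') g''\<close>.
\<close>

lemma second_deriv_functional_representer:
  assumes ab: "a < b" and R: "continuous_on {a..b} R"
  obtains h where "h \<in> W22 a b"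
    "\<And>g g1 g2. W22_rep a b g g1 g2 \<Longrightarrow> inner22 a b h g = integral_on a b (\<lambda>x. R x * g2 x)"
proof -
  obtain z z1 h0 h1 where z: "ac_on a b z z1" "ac_on a b z1 h0" "z a = 0" "z b = 0"
    and h0: "ac_on a b h0 h1" "ac_on a b h1 (\<lambda>x. R x + h0 x - z x)" "h0 a = 0" "h0 b = 0"
    by (rule fourth_order_problem[OF ab R])
  define h where "h = (\<lambda>x. if x \<in> {a..b} then h0 x else 0)"
  define h2 where "h2 = (\<lambda>x. R x + h0 x - z x)"
  have c: "continuous_on {a..b} h0" "continuous_on {a..b} z" "continuous_on {a..b} h2"
    unfolding h2_def using R ac_on_continuous[OF h0(1)] ac_on_continuous[OF z(1)] by (auto intro!: continuous_intros)
  have "ac_on a b h h1"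
    by (rule ac_on_cong[OF h0(1)]) (use ab in \<open>auto simp: h_def\<close>)
  hence rep: "W22_rep a b h h1 h2"
    using h0 ab continuous_L2_on[OF c(3)] by (auto simp: W22_rep_def h_def h2_def)
  have ab': "a \<le> b" using ab by simp
  show ?thesis
  proof (rule that[of h])
    show "h \<in> W22 a b" by (rule W22_rep_sobolev(1)[OF ab' rep])
    fix g g1 g2 assume g: "W22_rep a b g g1 g2"
    hence g1: "ac_on a b g g1" and g2: "ac_on a b g1 g2" and gz: "g a = 0" "g b = 0"
      by (auto simp: W22_rep_def)
    have "integral_on a b (\<lambda>x. h x * g x) = integral_on a b (\<lambda>x. h0 x * g x)"
      unfolding integral_on_def by (rule Bochner_Integration.integral_cong) (auto simp: h_def)
    also have "\<dots> = - integral_on a b (\<lambda>x. z1 x * g1 x)"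
      using integral_by_parts_ac[OF z(2) g1 ab'] gz by (simp add: integral_on_def)
    also have "\<dots> = integral_on a b (\<lambda>x. z x * g2 x)"
      using integral_by_parts_ac[OF z(1) g2 ab'] z by (simp add: integral_on_def)
    finally have 1: "integral_on a b (\<lambda>x. h x * g x) = integral_on a b (\<lambda>x. z x * g2 x)" .
    have 2: "integral_on a b (\<lambda>x. h1 x * g1 x) = - integral_on a b (\<lambda>x. h0 x * g2 x)"
      using integral_by_parts_ac[OF h0(1) g2 ab'] h0 by (simp add: integral_on_def)
    have i: "integrable (lebesgue_on {a..b}) (\<lambda>x. u x * g2 x)" if "continuous_on {a..b} u" for u
      by (rule integrable_continuous_mult[OF that ac_on_integrable[OF g2]])
    have "integral_on a b (\<lambda>x. z x * g2 x) - integral_on a b (\<lambda>x. h0 x * g2 x) + integral_on a b (\<lambda>x. h2 x * g2 x) =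
        integral_on a b (\<lambda>x. z x * g2 x - h0 x * g2 x + h2 x * g2 x)"
      using i[OF c(1)] i[OF c(2)] i[OF c(3)] by (simp add: integral_on_def)
    also have "(\<lambda>x. z x * g2 x - h0 x * g2 x + h2 x * g2 x) = (\<lambda>x. R x * g2 x)"
      by (simp add: h2_def algebra_simps)
    finally show "inner22 a b h g = integral_on a b (\<lambda>x. R x * g2 x)"
      unfolding inner22_rep[OF ab' rep g] 1 2 by simp
  qed
qed

section \<open>Operators associated with bilinear forms\<close>

lemma inner22_left_combination:
  assumes ab: "a < b" and f: "f \<in> W22 a b" and f': "f' \<in> W22 a b" and g: "g \<in> W22 a b"
  shows "inner22 a b (\<lambda>x. c * f x + d * f' x) g = c * inner22 a b f g + d * inner22 a b f' g"
proof -
  obtain f1 f2 f1' f2' g1 g2 where r: "W22_rep a b f f1 f2" "W22_rep a b f' f1' f2'" "W22_rep a b g g1 g2"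
    using W22_obtain_rep[OF ab] f f' g by metis
  have ab': "a \<le> b" using ab by simp
  have *: "integral_on a b (\<lambda>x. (c * u x + d * v x) * t x) = c * integral_on a b (\<lambda>x. u x * t x) + d * integral_on a b (\<lambda>x. v x * t x)"
    if "u \<in> L2_on a b" "v \<in> L2_on a b" "t \<in> L2_on a b" for u v t
    using L2_on_mult_integrable[OF that(1,3)] L2_on_mult_integrable[OF that(2,3)]
    by (simp add: integral_on_def distrib_right mult.assoc)
  note L = W22_rep_L2[OF r(1)] W22_rep_L2[OF r(2)] W22_rep_L2[OF r(3)]
  show ?thesis
    unfolding inner22_rep[OF ab' W22_rep_combination[OF r(1,2)] r(3)] inner22_rep[OF ab' r(1,3)] inner22_rep[OF ab' r(2,3)]
      *[OF L(1) L(4) L(7)] *[OF L(2) L(5) L(8)] *[OF L(3) L(6) L(9)]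
    by (simp add: algebra_simps)
qed

lemma W22_combination:
  assumes ab: "a < b" and "f \<in> W22 a b" "g \<in> W22 a b"
  shows "(\<lambda>x. c * f x + d * g x) \<in> W22 a b"
proof -
  obtain f1 f2 g1 g2 where "W22_rep a b f f1 f2" "W22_rep a b g g1 g2"
    using W22_obtain_rep[OF ab] assms by metis
  from W22_rep_sobolev(1)[OF _ W22_rep_combination[OF this]] ab show ?thesis by simp
qed

lemma integral_on_square_nonneg: "integral_on a b (\<lambda>x. u x * u x) \<ge> (0 :: real)"
  unfolding integral_on_def by (rule Bochner_Integration.integral_nonneg) simp

lemma inner22_self_ge:
  assumes ab: "a < b" and f: "W22_rep a b f f1 f2"
  shows "integral_on a b (\<lambda>x. f x * f x) \<le> inner22 a b f f"
    "integral_on a b (\<lambda>x. f1 x * f1 x) \<le> inner22 a b f f"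
    "integral_on a b (\<lambda>x. f2 x * f2 x) \<le> inner22 a b f f"
    "0 \<le> inner22 a b f f"
proof -
  have ab': "a \<le> b" using ab by simp
  show "integral_on a b (\<lambda>x. f x * f x) \<le> inner22 a b f f"
    "integral_on a b (\<lambda>x. f1 x * f1 x) \<le> inner22 a b f f"
    "integral_on a b (\<lambda>x. f2 x * f2 x) \<le> inner22 a b f f"
    "0 \<le> inner22 a b f f"
    using integral_on_square_nonneg[of a b f] integral_on_square_nonneg[of a b f1] integral_on_square_nonneg[of a b f2]
    by (auto simp: inner22_rep[OF ab' f f])
qed

lemma inner22_definite:
  assumes ab: "a < b" and f: "f \<in> W22 a b" and z: "inner22 a b f f = 0"
  shows "f x = 0"
proof -
  obtain f1 f2 where r: "W22_rep a b f f1 f2" using W22_obtain_rep[OF ab f] .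
  have "integral_on a b (\<lambda>x. f x * f x) = 0"
    using inner22_self_ge(1)[OF ab r] integral_on_square_nonneg[of a b f] z by simp
  moreover have "continuous_on {a..b} (\<lambda>x. f x * f x)"
    using ac_on_continuous[of a b f f1] r by (intro continuous_intros) (auto simp: W22_rep_def)
  ultimately have "\<forall>x\<in>{a..b}. f x * f x = 0"
    unfolding integral_on_def using integralL_eq_0_iff[of a b "\<lambda>x. f x * f x"] ab by simp
  with r show ?thesis by (cases "x \<in> {a..b}") (auto simp: W22_rep_def)
qed

text \<open>Testing the difference against itself gives norm zero, and the inner product is definite
  on functions, not just on classes, because elements of \<open>W22\<close> are continuous and fixed
  to 0 outside the interval.\<close>

lemma W22_representer_unique:
  assumes ab: "a < b" and h: "h \<in> W22 a b" and h': "h' \<in> W22 a b"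
    and eq: "\<And>g. g \<in> W22 a b \<Longrightarrow> inner22 a b h g = inner22 a b h' g"
  shows "h = h'"
proof
  fix x
  define d where "d = (\<lambda>x. 1 * h x + (-1) * h' x)"
  have d: "d \<in> W22 a b" unfolding d_def by (rule W22_combination[OF ab h h'])
  have "inner22 a b d d = 1 * inner22 a b h d + (-1) * inner22 a b h' d"
    unfolding d_def[symmetric] by (subst (1) d_def) (rule inner22_left_combination[OF ab h h' d])
  hence "inner22 a b d d = 0" using eq[OF d] by simp
  from inner22_definite[OF ab d this, of x] show "h x = h' x" by (simp add: d_def)
qed

text \<open>
  The bound is Cauchy--Schwarz before optimising in \<open>s\<close>; taking \<open>g = L f\<close> and \<open>s = 2 C\<close> lets the
  left-hand side \<open>\<langle>L f, L f\<rangle>\<^sub>2\<close> absorb the second summand.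
\<close>

lemma bilinear_form_operator:
  assumes ab: "a < b"
    and ex: "\<And>f. f \<in> W22 a b \<Longrightarrow> \<exists>h\<in>W22 a b. \<forall>g\<in>W22 a b. B f g = inner22 a b h g"
    and lin: "\<And>f f' g c d. f \<in> W22 a b \<Longrightarrow> f' \<in> W22 a b \<Longrightarrow> g \<in> W22 a b \<Longrightarrow>
       B (\<lambda>x. c * f x + d * f' x) g = c * B f g + d * B f' g"
    and C: "0 < C" and bound: "\<And>f g s. f \<in> W22 a b \<Longrightarrow> g \<in> W22 a b \<Longrightarrow> 0 < s \<Longrightarrow>
       \<bar>B f g\<bar> \<le> C * (s * inner22 a b f f + inner22 a b g g / s)"
  shows "\<exists>L. operator_on_W22 a b L \<and> (\<forall>f\<in>W22 a b. \<forall>g\<in>W22 a b. B f g = inner22 a b (L f) g)"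
proof -
  define L where "L = (\<lambda>f. SOME h. h \<in> W22 a b \<and> (\<forall>g\<in>W22 a b. B f g = inner22 a b h g))"
  have "L f \<in> W22 a b \<and> (\<forall>g\<in>W22 a b. B f g = inner22 a b (L f) g)" if "f \<in> W22 a b" for f
  proof -
    have "\<exists>h. h \<in> W22 a b \<and> (\<forall>g\<in>W22 a b. B f g = inner22 a b h g)" using ex[OF that] by blast
    thus ?thesis unfolding L_def by (rule someI_ex)
  qed
  hence LW: "L f \<in> W22 a b" and BL: "g \<in> W22 a b \<Longrightarrow> inner22 a b (L f) g = B f g" if "f \<in> W22 a b" for f g
    using that by auto
  have "L (\<lambda>x. c * f x + d * g x) = (\<lambda>x. c * L f x + d * L g x)" if f: "f \<in> W22 a b" and g: "g \<in> W22 a b" for f g c d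
  proof (rule W22_representer_unique[OF ab])
    show "L (\<lambda>x. c * f x + d * g x) \<in> W22 a b" by (rule LW[OF W22_combination[OF ab f g]])
    show "(\<lambda>x. c * L f x + d * L g x) \<in> W22 a b" by (rule W22_combination[OF ab LW[OF f] LW[OF g]])
    fix u assume u: "u \<in> W22 a b"
    show "inner22 a b (L (\<lambda>x. c * f x + d * g x)) u = inner22 a b (\<lambda>x. c * L f x + d * L g x) u"
      unfolding BL[OF W22_combination[OF ab f g] u] inner22_left_combination[OF ab LW[OF f] LW[OF g] u]
        BL[OF f u] BL[OF g u] by (rule lin[OF f g u])
  qed
  moreover have "norm22 a b (L f) \<le> (2 * C) * norm22 a b f" if f: "f \<in> W22 a b" for f
  proof -
    let ?n = "\<lambda>f. inner22 a b f f"
    have "?n (L f) = B f (L f)" by (rule BL[OF f LW[OF f]])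
    also have "\<dots> \<le> C * ((2 * C) * ?n f + ?n (L f) / (2 * C))"
      using bound[OF f LW[OF f], of "2 * C"] C by simp
    also have "\<dots> = 2 * C\<^sup>2 * ?n f + ?n (L f) / 2"
      using C by (simp add: field_simps power2_eq_square)
    finally have "?n (L f) \<le> (2 * C)\<^sup>2 * ?n f" by (simp add: power_mult_distrib)
    hence "sqrt (?n (L f)) \<le> sqrt ((2 * C)\<^sup>2 * ?n f)" by (rule real_sqrt_le_mono)
    thus ?thesis using C by (simp add: norm22_def real_sqrt_mult)
  qed
  ultimately have "operator_on_W22 a b L" using LW unfolding operator_on_W22_def by blast
  thus ?thesis using BL by auto
qed

text \<open>Young's inequality with parameter \<open>s\<close>, pointwise from the square of
  \<open>s * \<bar>u\<bar> - \<bar>v\<bar>\<close> and then integrated. The free parameter stands in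
  for Cauchy-Schwarz.\<close>

lemma integral_weighted_product_bound:
  fixes u v w :: "real \<Rightarrow> real"
  assumes u: "u \<in> L2_on a b" and v: "v \<in> L2_on a b" and w: "continuous_on {a..b} w"
    and K: "\<And>x. x \<in> {a..b} \<Longrightarrow> \<bar>w x\<bar> \<le> K" and s: "0 < s"
  shows "\<bar>integral_on a b (\<lambda>x. u x * v x * w x)\<bar> \<le>
     K * (s * integral_on a b (\<lambda>x. u x * u x) + integral_on a b (\<lambda>x. v x * v x) / s)"
proof -
  let ?M = "lebesgue_on {a..b}"
  note i = L2_on_mult_integrable[OF u u] L2_on_mult_integrable[OF v v]
  have "\<bar>integral\<^sup>L ?M (\<lambda>x. u x * v x * w x)\<bar> \<le> integral\<^sup>L ?M (\<lambda>x. K * (s * (u x * u x) + (v x * v x) / s))"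
  proof (rule integral_abs_bound_integral)
    show "integrable ?M (\<lambda>x. u x * v x * w x)" by (rule L2_on_mult_continuous_integrable[OF u v w])
    show "integrable ?M (\<lambda>x. K * (s * (u x * u x) + (v x * v x) / s))" using i by simp
    fix x assume "x \<in> space ?M"
    hence "\<bar>w x\<bar> \<le> K" using K by simp
    moreover have "\<bar>u x * v x\<bar> \<le> s * (u x * u x) + (v x * v x) / s"
    proof -
      have "0 \<le> (s * \<bar>u x\<bar> - \<bar>v x\<bar>)\<^sup>2 / s" using s by simp
      also have "\<dots> = s * (u x * u x) + (v x * v x) / s - 2 * \<bar>u x * v x\<bar>"
        using s by (simp add: power2_eq_square field_simps abs_mult)
      finally show ?thesis by simp
    qed
    ultimately have "\<bar>u x * v x\<bar> * \<bar>w x\<bar> \<le> (s * (u x * u x) + (v x * v x) / s) * K"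
      using s by (intro mult_mono) auto
    thus "\<bar>u x * v x * w x\<bar> \<le> K * (s * (u x * u x) + (v x * v x) / s)"
      by (simp add: abs_mult mult.commute)
  qed
  also have "\<dots> = K * (s * integral\<^sup>L ?M (\<lambda>x. u x * u x) + integral\<^sup>L ?M (\<lambda>x. v x * v x) / s)"
    using i by simp
  finally show ?thesis by (simp add: integral_on_def)
qed

text \<open>The common shape of both forms, prescribed on representatives only. Existence of the
  representer combines the reduction to a functional of \<open>g2\<close> with the boundary value
  problem; linearity and the bound are read off term by term.\<close>

lemma second_order_form_operator:
  assumes ab: "a < b" and w: "continuous_on {a..b} w0" "continuous_on {a..b} w1" "continuous_on {a..b} w2"
    and B: "\<And>f f1 f2 g g1 g2. W22_rep a b f f1 f2 \<Longrightarrow> W22_rep a b g g1 g2 \<Longrightarrow>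
       B f g = integral_on a b (\<lambda>x. f2 x * g x * w0 x) + integral_on a b (\<lambda>x. f1 x * g1 x * w1 x)
          + integral_on a b (\<lambda>x. f x * g2 x * w2 x)"
  shows "\<exists>L. operator_on_W22 a b L \<and> (\<forall>f\<in>W22 a b. \<forall>g\<in>W22 a b. B f g = inner22 a b (L f) g)"
proof -
  have "\<exists>K. \<forall>x\<in>{a..b}. \<bar>u x\<bar> \<le> K" if "continuous_on {a..b} u" for u :: "real \<Rightarrow> real"
    using compact_imp_bounded[OF compact_continuous_image[OF that compact_Icc]] unfolding bounded_iff by fastforce
  then obtain K0 K1 K2 where K: "\<forall>x\<in>{a..b}. \<bar>w0 x\<bar> \<le> K0" "\<forall>x\<in>{a..b}. \<bar>w1 x\<bar> \<le> K1" "\<forall>x\<in>{a..b}. \<bar>w2 x\<bar> \<le> K2"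
    using w by metis
  \<comment> \<open>One summand for each weighted integral; the maxima with 0 keep the factors
    nonnegative, and the final 1 makes \<open>C\<close> positive even if all weights vanish.\<close>
  define C where "C = max 0 K0 + max 0 K1 + max 0 K2 + 1"
  show ?thesis
  proof (rule bilinear_form_operator[OF ab, of _ C])
    fix f assume "f \<in> W22 a b"
    then obtain f1 f2 where f: "W22_rep a b f f1 f2" using W22_obtain_rep[OF ab] by metis
    have c: "continuous_on {a..b} f" "continuous_on {a..b} f1" "integrable (lebesgue_on {a..b}) f2"
      using f by (auto simp: W22_rep_def intro: ac_on_continuous ac_on_integrable)
    have p: "integrable (lebesgue_on {a..b}) (\<lambda>x. f2 x * w0 x)"
      using integrable_continuous_mult[OF w(1) c(3)] by (simp add: mult.commute)
    have q: "integrable (lebesgue_on {a..b}) (\<lambda>x. f1 x * w1 x)"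
      using c(2) w(2) by (intro continuous_imp_integrable_real continuous_intros)
    have r: "continuous_on {a..b} (\<lambda>x. f x * w2 x)"
      using c(1) w(3) by (intro continuous_intros)
    obtain R where R: "continuous_on {a..b} R"
      "\<And>g g1 g2. W22_rep a b g g1 g2 \<Longrightarrow>
      integral_on a b (\<lambda>x. f2 x * w0 x * g x) + integral_on a b (\<lambda>x. f1 x * w1 x * g1 x) + integral_on a b (\<lambda>x. f x * w2 x * g2 x)
      = integral_on a b (\<lambda>x. R x * g2 x)"
      using functional_as_second_deriv[OF ab p q r] by blast
    obtain h where h: "h \<in> W22 a b"
      "\<And>g g1 g2. W22_rep a b g g1 g2 \<Longrightarrow> inner22 a b h g = integral_on a b (\<lambda>x. R x * g2 x)"
      using second_deriv_functional_representer[OF ab R(1)] by blast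
    have "B f g = inner22 a b h g" if gW: "g \<in> W22 a b" for g
    proof -
      obtain g1 g2 where g: "W22_rep a b g g1 g2" using W22_obtain_rep[OF ab gW] .
      show ?thesis using B[OF f g] R(2)[OF g] h(2)[OF g] by (simp add: mult.assoc mult.commute[of "w0 _"] mult.commute[of "w1 _"] mult.commute[of "w2 _"])
    qed
    with h(1) show "\<exists>h\<in>W22 a b. \<forall>g\<in>W22 a b. B f g = inner22 a b h g" by blast
  next
    fix f f' g c d assume "f \<in> W22 a b" "f' \<in> W22 a b" "g \<in> W22 a b"
    then obtain f1 f2 f1' f2' g1 g2 where r: "W22_rep a b f f1 f2" "W22_rep a b f' f1' f2'" "W22_rep a b g g1 g2"
      using W22_obtain_rep[OF ab] by metis
    have *: "integral_on a b (\<lambda>x. (c * u x + d * v x) * t x * k x) =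
        c * integral_on a b (\<lambda>x. u x * t x * k x) + d * integral_on a b (\<lambda>x. v x * t x * k x)"
      if "u \<in> L2_on a b" "v \<in> L2_on a b" "t \<in> L2_on a b" "continuous_on {a..b} k" for u v t k
      using L2_on_mult_continuous_integrable[OF that(1,3,4)] L2_on_mult_continuous_integrable[OF that(2,3,4)]
      by (simp add: integral_on_def distrib_right mult.assoc)
    note L = W22_rep_L2[OF r(1)] W22_rep_L2[OF r(2)] W22_rep_L2[OF r(3)]
    show "B (\<lambda>x. c * f x + d * f' x) g = c * B f g + d * B f' g"
      unfolding B[OF W22_rep_combination[OF r(1,2)] r(3)] B[OF r(1,3)] B[OF r(2,3)]
        *[OF L(3) L(6) L(7) w(1)] *[OF L(2) L(5) L(8) w(2)] *[OF L(1) L(4) L(9) w(3)]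
      by (simp add: algebra_simps)
  next
    show "0 < C" by (simp add: C_def add_nonneg_pos)
    fix f g s assume "f \<in> W22 a b" "g \<in> W22 a b" and s: "0 < (s :: real)"
    then obtain f1 f2 g1 g2 where f: "W22_rep a b f f1 f2" and g: "W22_rep a b g g1 g2"
      using W22_obtain_rep[OF ab] by metis
    note F = W22_rep_L2[OF f] inner22_self_ge[OF ab f] and G = W22_rep_L2[OF g] inner22_self_ge[OF ab g]
    define N where "N = s * inner22 a b f f + inner22 a b g g / s"
    have N: "0 \<le> N" using F(7) G(7) s by (simp add: N_def)
    have *: "\<bar>integral_on a b (\<lambda>x. u x * v x * k x)\<bar> \<le> max 0 K * N"
      if "u \<in> L2_on a b" "v \<in> L2_on a b" "continuous_on {a..b} k" "\<forall>x\<in>{a..b}. \<bar>k x\<bar> \<le> K"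
        "integral_on a b (\<lambda>x. u x * u x) \<le> inner22 a b f f" "integral_on a b (\<lambda>x. v x * v x) \<le> inner22 a b g g"
      for u v k K
    proof -
      have "\<bar>integral_on a b (\<lambda>x. u x * v x * k x)\<bar> \<le>
        max 0 K * (s * integral_on a b (\<lambda>x. u x * u x) + integral_on a b (\<lambda>x. v x * v x) / s)"
        by (rule integral_weighted_product_bound[OF that(1-3) _ s]) (use that(4) in force)
      also have "\<dots> \<le> max 0 K * N"
        unfolding N_def using that(5,6) s by (intro mult_left_mono add_mono divide_right_mono) auto
      finally show ?thesis .
    qed
    have "\<bar>B f g\<bar> \<le> max 0 K0 * N + max 0 K1 * N + max 0 K2 * N"
      unfolding B[OF f g]
      using *[OF F(3) G(1) w(1) K(1) F(6) G(4)] *[OF F(2) G(2) w(2) K(2) F(5) G(5)] *[OF F(1) G(3) w(3) K(3) F(4) G(6)]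
      by linarith
    also have "\<dots> \<le> C * N" using N by (simp add: C_def distrib_right)
    finally show "\<bar>B f g\<bar> \<le> C * (s * inner22 a b f f + inner22 a b g g / s)" by (simp add: N_def)
  qed
qed

section \<open>The two concrete forms and their sum\<close>

lemma form_eps1_operator:
  assumes ab: "a < b" and w: "continuous_on {a..b} w"
  shows "\<exists>L. operator_on_W22 a b L \<and> (\<forall>f\<in>W22 a b. \<forall>g\<in>W22 a b. form_eps1 a b w f g = inner22 a b (L f) g)"
proof (rule second_order_form_operator[OF ab])
  show c: "continuous_on {a..b} (\<lambda>x. w x / 4)" "continuous_on {a..b} (\<lambda>x. w x / 2 - 1 / 4)" "continuous_on {a..b} (\<lambda>x. w x / 4)"
    using w by (auto intro!: continuous_intros)
  fix f f1 f2 g g1 g2 assume f: "W22_rep a b f f1 f2" and g: "W22_rep a b g g1 g2"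
  have ab': "a \<le> b" using ab by simp
  have "integral_on a b (\<lambda>x. f1 x * g1 x * (w x / 2 - 1 / 4)) =
     integral_on a b (\<lambda>x. f1 x * g1 x * w x) / 2 - integral_on a b (\<lambda>x. f1 x * g1 x) / 4"
    using L2_on_mult_continuous_integrable[OF W22_rep_L2(2)[OF f] W22_rep_L2(2)[OF g] w]
      L2_on_mult_integrable[OF W22_rep_L2(2)[OF f] W22_rep_L2(2)[OF g]]
    by (simp add: integral_on_def right_diff_distrib)
  thus "form_eps1 a b w f g = integral_on a b (\<lambda>x. f2 x * g x * (w x / 4)) +
      integral_on a b (\<lambda>x. f1 x * g1 x * (w x / 2 - 1 / 4)) + integral_on a b (\<lambda>x. f x * g2 x * (w x / 4))"
    unfolding form_eps1_rep[OF ab' w f g] by (simp add: integral_on_def)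
qed

text \<open>The weights of \<open>f2 * g\<close> and \<open>f * g2\<close> have opposite signs here,
  which is why the general lemma keeps them independent and assumes no symmetry.\<close>

lemma form_eps2_operator:
  assumes ab: "a < b" and w: "continuous_on {a..b} w"
  shows "\<exists>L. operator_on_W22 a b L \<and> (\<forall>f\<in>W22 a b. \<forall>g\<in>W22 a b. form_eps2 a b w f g = inner22 a b (L f) g)"
proof (rule second_order_form_operator[OF ab])
  show "continuous_on {a..b} (\<lambda>x. w x / 4)" "continuous_on {a..b} (\<lambda>x. - 1 / 4 :: real)" "continuous_on {a..b} (\<lambda>x. - w x / 4)"
    using w by (auto intro!: continuous_intros)
  fix f f1 f2 g g1 g2 assume f: "W22_rep a b f f1 f2" and g: "W22_rep a b g g1 g2"
  have ab': "a \<le> b" using ab by simp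
  show "form_eps2 a b w f g = integral_on a b (\<lambda>x. f2 x * g x * (w x / 4)) +
      integral_on a b (\<lambda>x. f1 x * g1 x * (- 1 / 4)) + integral_on a b (\<lambda>x. f x * g2 x * (- w x / 4))"
    unfolding form_eps2_rep[OF ab' w f g] by (simp add: integral_on_def)
qed

theorem mainTheorem8:
  fixes M :: "'w measure" and a b :: real and W :: "real \<Rightarrow> 'w \<Rightarrow> real"
  assumes "a < b"
    and "brownian_motion_on M a b W"
  shows "\<forall>\<omega>\<in>space M.
    (\<forall>f\<in>W22 a b. \<forall>h\<in>W22 a b.
       form_eps a b (\<lambda>t. W t \<omega>) f h =
       form_eps1 a b (\<lambda>t. W t \<omega>) f h + form_eps2 a b (\<lambda>t. W t \<omega>) f h) \<and>
    (\<exists>L1 L2. operator_on_W22 a b L1 \<and> operator_on_W22 a b L2 \<and>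
       (\<forall>f\<in>W22 a b. \<forall>g\<in>W22 a b.
          form_eps1 a b (\<lambda>t. W t \<omega>) f g = inner22 a b (L1 f) g) \<and>
       (\<forall>f\<in>W22 a b. \<forall>g\<in>W22 a b.
          form_eps2 a b (\<lambda>t. W t \<omega>) f g = inner22 a b (L2 f) g) \<and>
       (\<forall>f\<in>W22 a b. \<forall>g\<in>W22 a b.
          form_eps a b (\<lambda>t. W t \<omega>) f g = inner22 a b (\<lambda>x. L1 f x + L2 f x) g))"
proof
  fix \<omega> assume "\<omega> \<in> space M"
  with assms(2) have w: "continuous_on {a..b} (\<lambda>t. W t \<omega>)" by (simp add: brownian_motion_on_def)
  let ?w = "\<lambda>t. W t \<omega>"
  note dec = form_eps_decomposition[OF assms(1) w]
  obtain L1 where L1: "operator_on_W22 a b L1"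
    "\<And>f g. f \<in> W22 a b \<Longrightarrow> g \<in> W22 a b \<Longrightarrow> form_eps1 a b ?w f g = inner22 a b (L1 f) g"
    using form_eps1_operator[OF assms(1) w] by blast
  obtain L2 where L2: "operator_on_W22 a b L2"
    "\<And>f g. f \<in> W22 a b \<Longrightarrow> g \<in> W22 a b \<Longrightarrow> form_eps2 a b ?w f g = inner22 a b (L2 f) g"
    using form_eps2_operator[OF assms(1) w] by blast
  have "form_eps a b ?w f g = inner22 a b (\<lambda>x. L1 f x + L2 f x) g" if f: "f \<in> W22 a b" and g: "g \<in> W22 a b" for f g
  proof -
    have "L1 f \<in> W22 a b" "L2 f \<in> W22 a b"
      using L1(1) L2(1) f by (auto simp: operator_on_W22_def)
    \<comment> \<open>With both coefficients equal to 1, left linearity says that the sum of the two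
      representers represents the sum of the two forms.\<close>
    from inner22_left_combination[OF assms(1) this g, of 1 1]
    show ?thesis using dec[OF f g] L1(2)[OF f g] L2(2)[OF f g] by simp
  qed
  with L1 L2 dec show "(\<forall>f\<in>W22 a b. \<forall>h\<in>W22 a b. form_eps a b ?w f h = form_eps1 a b ?w f h + form_eps2 a b ?w f h) \<and>
    (\<exists>L1 L2. operator_on_W22 a b L1 \<and> operator_on_W22 a b L2 \<and>
       (\<forall>f\<in>W22 a b. \<forall>g\<in>W22 a b. form_eps1 a b ?w f g = inner22 a b (L1 f) g) \<and>
       (\<forall>f\<in>W22 a b. \<forall>g\<in>W22 a b. form_eps2 a b ?w f g = inner22 a b (L2 f) g) \<and>
       (\<forall>f\<in>W22 a b. \<forall>g\<in>W22 a b. form_eps a b ?w f g = inner22 a b (\<lambda>x. L1 f x + L2 f x) g))"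
    by blast
qed

end
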